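(* Let $p$ be a prime and let $G$ be a finitely generated FAb profinite group which is infinite and virtually a pro-$p$ group. If $G$ has rational representation zeta function with respect to $p$, then $\zeta_G(-2) = 0$.
   Context: A profinite group $G$ is FAb if $H/[H,H]$ is finite for every open subgroup $H$ of $G$ (here $[H,H]$ is the commutator subgroup, in the sense of topological groups). It is virtually pro-$p$ if it has an open pro-$p$ subgroup. $\mathrm{Irr}(G)$ denotes the set of all continuous irreducible complex characters of a profinite group $G$; each has finite degree $\chi(1)$. For $n \in \mathbb{N}$ put $r_n(G) = |\{\chi \in \mathrm{Irr}(G) \mid \chi(1) = n\}|$. If $G$ is finitely generated and FAb, then $r_n(G)$ is finite for all $n$, and the representation zeta function of $G$ is the Dirichlet series $$\zeta_G(s) = \sum_{n=1}^\infty r_n(G)\, n^{-s} = \sum_{\chi \in \mathrm{Irr}(G)} \chi(1)^{-s}.$$ Let $G$ be a finitely generated profinite group which is FAb and virtually pro-$p$. One says that $G$ has rational representation zeta function (with respect to $p$) if there exist finitely many positive integers $m_1, \ldots, m_k$ and rational functions $R_1, \ldots, R_k \in \mathbb{Q}(X)$ such that $$\zeta_G(s) = \sum_{i=1}^k m_i^{-s} R_i(p^{-s}),$$ the equality being understood on some right half-plane of $\mathbb{C}$ on which the Dirichlet series converges. The right-hand side then provides a meromorphic continuation of $\zeta_G(s)$ to all of $\mathbb{C}$, and $\zeta_G(-2)$ denotes the value of this continuation at $s=-2$. *)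

theory Defs
  imports
    "HOL-Complex_Analysis.Complex_Analysis"
    "HOL-Algebra.Algebra"
    "HOL-Computational_Algebra.Computational_Algebra"
    "HOL-Computational_Algebra.Field_as_Ring"
    "Jordan_Normal_Form.VS_Connect"
begin

hide_const (open) Divisibility.prime

subsection \<open>Profinite groups\<close>

locale topological_group = group G for G (structure) +
  fixes T :: "'a topology"
  assumes topspace_eq: "topspace T = carrier G"
    and continuous_mult: "continuous_map (prod_topology T T) T (\<lambda>(x, y). x \<otimes> y)"
    and continuous_inv: "continuous_map T T (\<lambda>x. inv x)"

locale profinite_group = topological_group +
  assumes compact: "compact_space T"
    and Hausdorff: "Hausdorff_space T"
    and totally_disconnected: "connectedin T S \<Longrightarrow> \<exists>a. S \<subseteq> {a}"

text \<open>\<open>order (G Mod N) = p ^ k\<close> with \<open>p > 0\<close> forces the quotient to be finite, because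
  \<^const>\<open>card\<close> is \<open>0\<close> on infinite sets.\<close>

definition pro_p_group :: "nat \<Rightarrow> ('a, 'b) monoid_scheme \<Rightarrow> 'a topology \<Rightarrow> bool" where
  "pro_p_group p G T \<longleftrightarrow> profinite_group G T \<and>
     (\<forall>N. N \<lhd> G \<and> openin T N \<longrightarrow> (\<exists>k. order (G Mod N) = p ^ k))"

definition virtually_pro_p :: "nat \<Rightarrow> ('a, 'b) monoid_scheme \<Rightarrow> 'a topology \<Rightarrow> bool" where
  "virtually_pro_p p G T \<longleftrightarrow>
     (\<exists>H. subgroup H G \<and> openin T H \<and> pro_p_group p (G\<lparr>carrier := H\<rparr>) (subtopology T H))"

definition topologically_fin_gen :: "('a, 'b) monoid_scheme \<Rightarrow> 'a topology \<Rightarrow> bool" where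
  "topologically_fin_gen G T \<longleftrightarrow>
     (\<exists>S. finite S \<and> S \<subseteq> carrier G \<and> T closure_of (generate G S) = carrier G)"

text \<open>The commutator subgroup of a topological group is the closure of the abstract one; for an
  open, hence closed, subgroup \<open>H\<close> the closures in \<open>H\<close> and in \<open>G\<close> agree.\<close>

definition FAb :: "('a, 'b) monoid_scheme \<Rightarrow> 'a topology \<Rightarrow> bool" where
  "FAb G T \<longleftrightarrow>
     (\<forall>H. subgroup H G \<and> openin T H \<longrightarrow>
        finite (carrier (G\<lparr>carrier := H\<rparr> Mod (T closure_of derived G H))))"


subsection \<open>Continuous irreducible complex characters\<close>

definition continuous_rep ::
  "('a, 'b) monoid_scheme \<Rightarrow> 'a topology \<Rightarrow> nat \<Rightarrow> ('a \<Rightarrow> complex mat) \<Rightarrow> bool" where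
  "continuous_rep G T n \<rho> \<longleftrightarrow>
     \<rho> \<in> hom G (units_of (ring_mat TYPE(complex) n ())) \<and>
     (\<forall>i<n. \<forall>j<n. continuous_map T euclidean (\<lambda>g. \<rho> g $$ (i, j)))"

definition irreducible_rep ::
  "('a, 'b) monoid_scheme \<Rightarrow> nat \<Rightarrow> ('a \<Rightarrow> complex mat) \<Rightarrow> bool" where
  "irreducible_rep G n \<rho> \<longleftrightarrow> n > 0 \<and>
     (\<forall>W. VectorSpace.subspace class_ring W (module_vec TYPE(complex) n) \<and>
          (\<forall>g\<in>carrier G. \<forall>w\<in>W. \<rho> g *\<^sub>v w \<in> W) \<longrightarrow>
          W = {0\<^sub>v n} \<or> W = carrier_vec n)"

definition mat_trace :: "complex mat \<Rightarrow> complex" where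
  "mat_trace A = (\<Sum>i<dim_row A. A $$ (i, i))"

text \<open>Characters are restricted to the carrier, so that two of them are equal as HOL functions
  if and only if they agree on the group.\<close>

definition Irr :: "('a, 'b) monoid_scheme \<Rightarrow> 'a topology \<Rightarrow> ('a \<Rightarrow> complex) set" where
  "Irr G T = {\<phi>. \<exists>n \<rho>. continuous_rep G T n \<rho> \<and> irreducible_rep G n \<rho> \<and>
                       \<phi> = (\<lambda>g\<in>carrier G. mat_trace (\<rho> g))}"

definition rep_count :: "('a, 'b) monoid_scheme \<Rightarrow> 'a topology \<Rightarrow> nat \<Rightarrow> nat" where
  "rep_count G T n = card {\<phi> \<in> Irr G T. \<phi> \<one>\<^bsub>G\<^esub> = of_nat n}"


subsection \<open>The representation zeta function\<close>

definition rep_zeta_converges ::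
  "('a, 'b) monoid_scheme \<Rightarrow> 'a topology \<Rightarrow> complex \<Rightarrow> bool" where
  "rep_zeta_converges G T s \<longleftrightarrow> (\<lambda>\<phi>. \<phi> \<one>\<^bsub>G\<^esub> powr (-s)) summable_on Irr G T"

definition rep_zeta :: "('a, 'b) monoid_scheme \<Rightarrow> 'a topology \<Rightarrow> complex \<Rightarrow> complex" where
  "rep_zeta G T s = (\<Sum>\<^sub>\<infinity>\<phi>\<in>Irr G T. \<phi> \<one>\<^bsub>G\<^esub> powr (-s))"

lemma Irr_degree:
  assumes "group G" "\<phi> \<in> Irr G T"
  shows "\<exists>n>0. \<phi> \<one>\<^bsub>G\<^esub> = of_nat n"
proof -
  interpret G: group G by fact
  obtain n \<rho> where r: "continuous_rep G T n \<rho>" "irreducible_rep G n \<rho>"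
    and x: "\<phi> = (\<lambda>g\<in>carrier G. mat_trace (\<rho> g))"
    using assms(2) unfolding Irr_def by blast
  interpret R: ring "ring_mat TYPE(complex) n ()" by (rule ring_mat)
  interpret U: group "units_of (ring_mat TYPE(complex) n ())" by (rule R.units_group)
  have "\<rho> \<one>\<^bsub>G\<^esub> = \<one>\<^bsub>units_of (ring_mat TYPE(complex) n ())\<^esub>"
    using r(1) hom_one[OF _ assms(1) U.group_axioms] unfolding continuous_rep_def by blast
  then have "\<rho> \<one>\<^bsub>G\<^esub> = 1\<^sub>m n" by (simp add: units_of_one ring_mat_simps)
  then have "\<phi> \<one>\<^bsub>G\<^esub> = of_nat n" by (simp add: x mat_trace_def)
  moreover have "n > 0" using r(2) unfolding irreducible_rep_def by blast
  ultimately show ?thesis by blast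
qed

text \<open>The two usual forms of the Dirichlet series agree. In particular, no degree with infinitely
  many characters (on which \<^const>\<open>card\<close> would be \<open>0\<close>) can occur where the series converges.\<close>

lemma rep_zeta_Dirichlet_series:
  assumes G: "group G" and conv: "rep_zeta_converges G T s"
  shows "finite {\<phi> \<in> Irr G T. \<phi> \<one>\<^bsub>G\<^esub> = of_nat n}"
    and "(\<lambda>n. of_nat (rep_count G T (Suc n)) * of_nat (Suc n) powr (-s)) sums rep_zeta G T s"
proof -
  define f where "f = (\<lambda>\<phi>. \<phi> \<one>\<^bsub>G\<^esub> powr (-s) :: complex)"
  define A where "A = (\<lambda>n::nat. {\<phi> \<in> Irr G T. \<phi> \<one>\<^bsub>G\<^esub> = of_nat n})"
  have sf: "f summable_on Irr G T" using conv unfolding rep_zeta_converges_def f_def .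
  have fA: "f \<phi> = of_nat n powr (-s)" if "\<phi> \<in> A n" for \<phi> n
    using that by (simp add: A_def f_def)
  have fin: "finite (A n)" for n
  proof (cases "n = 0")
    case True
    then have "A n = {}" using Irr_degree[OF G] by (fastforce simp: A_def)
    then show ?thesis by simp
  next
    case False
    have "f summable_on A n" by (rule summable_on_subset_banach[OF sf]) (auto simp: A_def)
    then have "(\<lambda>_. of_nat n powr (-s) :: complex) summable_on A n"
      using summable_on_cong[of "A n" f "\<lambda>_. of_nat n powr (-s)", OF fA] by simp
    then have "(\<lambda>_. norm (of_nat n powr (-s) :: complex)) summable_on A n"
      by (simp add: summable_on_iff_abs_summable_on_complex)
    then show ?thesis
      using False infsum_diverge_constant[of "A n" "norm (of_nat n powr (-s) :: complex)"] by auto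
  qed
  show "finite {\<phi> \<in> Irr G T. \<phi> \<one>\<^bsub>G\<^esub> = of_nat n}" using fin unfolding A_def by blast
  have bij: "bij_betw snd (Sigma UNIV (\<lambda>n. A (Suc n))) (Irr G T)"
  proof (rule bij_betwI')
    fix x y assume "x \<in> Sigma UNIV (\<lambda>n. A (Suc n))" "y \<in> Sigma UNIV (\<lambda>n. A (Suc n))"
    then show "(snd x = snd y) = (x = y)"
      by (auto simp: A_def simp del: of_nat_Suc)
  next
    fix x assume "x \<in> Sigma UNIV (\<lambda>n. A (Suc n))"
    then show "snd x \<in> Irr G T" by (auto simp: A_def)
  next
    fix y assume y: "y \<in> Irr G T"
    obtain n where "n > 0" "y \<one>\<^bsub>G\<^esub> = of_nat n" using Irr_degree[OF G y] by blast
    then have "y \<in> A (Suc (n - 1))" using y by (simp add: A_def)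
    then show "\<exists>x\<in>Sigma UNIV (\<lambda>n. A (Suc n)). y = snd x" by force
  qed
  have "(f has_sum rep_zeta G T s) (Irr G T)"
    using has_sum_infsum[OF sf] unfolding rep_zeta_def f_def .
  then have "((\<lambda>x. f (snd x)) has_sum rep_zeta G T s) (Sigma UNIV (\<lambda>n. A (Suc n)))"
    using has_sum_reindex_bij_betw[OF bij] by blast
  then have "((\<lambda>n. of_nat (card (A (Suc n))) * of_nat (Suc n) powr (-s)) has_sum rep_zeta G T s)
      (UNIV :: nat set)"
  proof (rule has_sum_SigmaD)
    fix n :: nat
    have "((\<lambda>y. f y) has_sum (\<Sum>y\<in>A (Suc n). f y)) (A (Suc n))"
      using fin by (rule has_sum_finite)
    also have "(\<Sum>y\<in>A (Suc n). f y) = of_nat (card (A (Suc n))) * of_nat (Suc n) powr (-s)"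
      using fA[of _ "Suc n"] by simp
    finally show "((\<lambda>y. f (snd (n, y))) has_sum
        (of_nat (card (A (Suc n))) * of_nat (Suc n) powr (-s))) (A (Suc n))" by simp
  qed
  then show "(\<lambda>n. of_nat (rep_count G T (Suc n)) * of_nat (Suc n) powr (-s)) sums rep_zeta G T s"
    unfolding A_def rep_count_def by (rule has_sum_imp_sums)
qed

definition extends_rep_zeta ::
  "('a, 'b) monoid_scheme \<Rightarrow> 'a topology \<Rightarrow> (complex \<Rightarrow> complex) \<Rightarrow> bool" where
  "extends_rep_zeta G T F \<longleftrightarrow>
     (\<exists>\<sigma>::real. \<forall>s. Re s > \<sigma> \<longrightarrow> rep_zeta_converges G T s \<and> rep_zeta G T s = F s)"

text \<open>\<^const>\<open>quot_of_fract\<close> yields numerator and (nonzero) denominator in lowest terms. At a pole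
  the value is \<open>0\<close> by the division convention.\<close>

definition eval_ratfun :: "rat poly fract \<Rightarrow> complex \<Rightarrow> complex" where
  "eval_ratfun R x =
     poly (map_poly of_rat (fst (quot_of_fract R))) x /
     poly (map_poly of_rat (snd (quot_of_fract R))) x"

text \<open>The values of \<^const>\<open>eval_ratfun\<close> at poles are irrelevant below: rational functions have only
  finitely many poles, none of which is of the form \<open>p\<^sup>-\<^sup>s\<close> once the real part of \<open>s\<close> is large.\<close>

definition has_rational_rep_zeta ::
  "nat \<Rightarrow> ('a, 'b) monoid_scheme \<Rightarrow> 'a topology \<Rightarrow> bool" where
  "has_rational_rep_zeta p G T \<longleftrightarrow>
     (\<exists>(k::nat) (m::nat \<Rightarrow> nat) (R::nat \<Rightarrow> rat poly fract).
        (\<forall>i<k. m i > 0) \<and>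
        extends_rep_zeta G T
          (\<lambda>s. \<Sum>i<k. of_nat (m i) powr (-s) * eval_ratfun (R i) (of_nat p powr (-s))))"

text \<open>A nicely meromorphic function has no removable singularities and takes the value \<open>0\<close> at its
  poles; this makes the continuation unique as a total function. A statement about a value of the
  continuation must therefore also say that the point is not a pole.\<close>

definition rep_zeta_continuation ::
  "('a, 'b) monoid_scheme \<Rightarrow> 'a topology \<Rightarrow> complex \<Rightarrow> complex" where
  "rep_zeta_continuation G T = (THE F. F nicely_meromorphic_on UNIV \<and> extends_rep_zeta G T F)"

lemma rep_zeta_continuation_unique:
  assumes "F nicely_meromorphic_on UNIV" "extends_rep_zeta G T F"
  shows "rep_zeta_continuation G T = F"
  unfolding rep_zeta_continuation_def
proof (rule the_equality)
  fix F' assume F': "F' nicely_meromorphic_on UNIV \<and> extends_rep_zeta G T F'"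
  obtain a where a: "\<And>s. Re s > a \<Longrightarrow> rep_zeta G T s = F s"
    using assms(2) unfolding extends_rep_zeta_def by blast
  obtain b where b: "\<And>s. Re s > b \<Longrightarrow> rep_zeta G T s = F' s"
    using F' unfolding extends_rep_zeta_def by blast
  have mero: "(\<lambda>s. F s - F' s) meromorphic_on UNIV"
    using assms(1) F' unfolding nicely_meromorphic_on_def by (auto intro!: meromorphic_intros)
  define z where "z = complex_of_real (max a b + 1)"
  have "z \<in> {s. Re s > max a b}"
    unfolding z_def mem_Collect_eq Re_complex_of_real by linarith
  with open_halfspace_Re_gt[of "max a b"] have "eventually (\<lambda>s. s \<in> {s. Re s > max a b}) (at z)"
    by (rule eventually_at_in_open')
  then have near: "eventually (\<lambda>s. F s - F' s = 0) (at z)"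
    by eventually_elim (simp flip: a b)
  have "\<not> eventually (\<lambda>s. F s - F' s \<noteq> 0) (cosparse UNIV)"
  proof
    assume "eventually (\<lambda>s. F s - F' s \<noteq> 0) (cosparse UNIV)"
    then have "eventually (\<lambda>s. F s - F' s \<noteq> 0) (at z)"
      by (auto simp: eventually_cosparse_open_eq)
    with near have "eventually (\<lambda>s. False) (at z)"
      by eventually_elim auto
    then show False by simp
  qed
  then have "eventually (\<lambda>s. F s - F' s = 0) (cosparse UNIV)"
    using meromorphic_imp_constant_or_avoid[OF mero, of 0] by blast
  then have ev: "eventually (\<lambda>w. F w = F' w) (at s)" for s
    by (auto simp: eventually_cosparse_open_eq)
  have nice: "remove_sings f s = f s" if "f nicely_meromorphic_on UNIV" for f s
    using that unfolding nicely_meromorphic_on_def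
    by (metis UNIV_I remove_sings_at_pole remove_sings_eqI)
  have "F s = F' s" for s
    using remove_sings_cong[OF ev refl, of s] nice[OF assms(1)] nice[of F'] F' by simp
  then show "F' = F" by auto
qed (use assms in auto)

end

theory Submission
  imports Defs "Jordan_Normal_Form.DL_Rank" "Jordan_Normal_Form.Spectral_Radius"
begin

text \<open>
  Formally \<open>\<zeta>\<^sub>G(-2)\<close> is the sum of the squares of all character degrees. For an open normal
  subgroup \<open>K\<close> the characters of \<open>G/K\<close> contribute exactly \<open>|G/K|\<close>, and since \<open>G\<close> is infinite and
  virtually pro-\<open>p\<close>, this is divisible by any given power of \<open>p\<close> once \<open>K\<close> is small. Hence the sum
  tends to \<open>0\<close> in the \<open>p\<close>-adic sense.

  Rationality turns this into a statement about the continuation: uniqueness of Dirichlet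
  coefficients gives a nonzero integer polynomial \<open>D\<close> such that \<open>D(p\<^sup>-\<^sup>s) \<zeta>\<^sub>G(s)\<close> is a Dirichlet
  polynomial \<open>\<Sum>\<^sub>n c\<^sub>n n\<^sup>-\<^sup>s\<close> with integer coefficients. If \<open>D\<close> has minimal degree, then \<open>D(p\<^sup>2)\<close>
  does not vanish, so that \<open>-2\<close> is not a pole, and \<open>\<Sum>\<^sub>n c\<^sub>n n\<^sup>2\<close> is an integer that is congruent to
  \<open>D(p\<^sup>2)\<close> times a partial sum of squared degrees modulo any power of \<open>p\<close>, hence \<open>0\<close>.
\<close>

text \<open>As a series of complex numbers the sum of squared degrees diverges, so nothing can be
  read off the Dirichlet series at -2 itself. The bridge is a finitely supported integer function:
  its Dirichlet polynomial can be evaluated at -2 in the complex sense, and the same integer can be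
  studied modulo powers of \<open>p\<close>. Minimality of the degree of \<open>D\<close> serves a
  second purpose: it forces D(0) \<noteq> 0. Then \<open>D\<close> is invertible as a rational power
  series, and this leaves only finitely many degrees that are not divisible by a given
  \<open>p ^ N\<close>. All characters of these degrees factor through one finite quotient, where
  the sum of squares formula applies, while the remaining characters of that quotient contribute
  multiples of \<open>p ^ N\<close>.\<close>

hide_const (open) up_ring.coeff up_ring.monom Polynomials.degree

subsection \<open>Polynomials in a dilation acting on arithmetic functions\<close>

text \<open>On Dirichlet series \<open>\<Sum>\<^sub>n r\<^sub>n n\<^sup>-\<^sup>s\<close>, dilation by \<open>p\<close> is multiplication by \<open>p\<^sup>-\<^sup>s\<close>, and the
  second moment is the value at \<open>s = -2\<close>.\<close>

definition dilate :: "nat \<Rightarrow> (nat \<Rightarrow> int) \<Rightarrow> nat \<Rightarrow> int" where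
  "dilate p r n = (if p dvd n then r (n div p) else 0)"

text \<open>This is multiplication of a Dirichlet series by D(p^(-s)). The coefficients are integers
  because the argument ends in divisibility by powers of \<open>p\<close>.\<close>

definition poly_act :: "nat \<Rightarrow> int poly \<Rightarrow> (nat \<Rightarrow> int) \<Rightarrow> nat \<Rightarrow> int" where
  "poly_act p D r n = (\<Sum>l\<le>degree D. coeff D l * dilate (p ^ l) r n)"

lemma poly_act_bound:
  assumes "degree D \<le> N"
  shows "poly_act p D r n = (\<Sum>l\<le>N. coeff D l * dilate (p ^ l) r n)"
  unfolding poly_act_def using assms
  by (intro sum.mono_neutral_left) (auto simp: coeff_eq_0)

lemma poly_act_0 [simp]: "poly_act p 0 r n = 0"
  by (simp add: poly_act_def)

lemma poly_act_add: "poly_act p (D + E) r n = poly_act p D r n + poly_act p E r n"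
proof -
  define N where "N = max (degree D) (degree E)"
  have "degree (D + E) \<le> N" "degree D \<le> N" "degree E \<le> N"
    unfolding N_def by (auto intro: degree_add_le_max)
  then show ?thesis
    by (simp add: poly_act_bound[where N = N] sum.distrib algebra_simps)
qed

lemma poly_act_smult: "poly_act p (Polynomial.smult a D) r n = a * poly_act p D r n"
  by (simp add: poly_act_bound[where N = "degree D"] degree_smult_le sum_distrib_left mult.assoc)

lemma dilate_dilate:
  assumes "p > 0"
  shows "dilate (p * q) r n = dilate p (dilate q r) n"
proof (cases "p dvd n")
  case True
  then obtain m where "n = p * m" by auto
  then show ?thesis using assms by (simp add: dilate_def)
next
  case False
  then show ?thesis by (auto simp: dilate_def dest: dvd_mult_left)
qed

text \<open>Horner's rule for the action. The inductions on \<open>D\<close> for supports, second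
  moments and Dirichlet sums all run through it.\<close>

lemma poly_act_pCons:
  assumes "p > 0"
  shows "poly_act p (pCons a D) r n = a * r n + dilate p (poly_act p D r) n"
proof -
  have "poly_act p (pCons a D) r n =
      (\<Sum>l\<le>Suc (degree D). coeff (pCons a D) l * dilate (p ^ l) r n)"
    by (rule poly_act_bound) (rule degree_pCons_le)
  also have "\<dots> = a * r n + (\<Sum>l\<le>degree D. coeff D l * dilate (p * p ^ l) r n)"
    by (subst sum.atMost_Suc_shift) (simp add: dilate_def)
  also have "(\<Sum>l\<le>degree D. coeff D l * dilate (p * p ^ l) r n) = dilate p (poly_act p D r) n"
    unfolding dilate_dilate[OF assms] by (auto simp: dilate_def[of p] poly_act_def)
  finally show ?thesis .
qed

lemma poly_act_minus_right:
  "poly_act p D (\<lambda>n. r n - r' n) n = poly_act p D r n - poly_act p D r' n"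
  by (auto simp: poly_act_def dilate_def sum_subtractf [symmetric] algebra_simps intro!: sum.cong)

text \<open>Dirichlet sums do not see the index 0, since \<open>0 powr z\<close> is 0. Vanishing
  there is not a consequence of comparing series and is tracked separately.\<close>

lemma poly_act_at_0:
  assumes "r 0 = 0"
  shows "poly_act p D r 0 = 0"
  using assms by (simp add: poly_act_def dilate_def)

text \<open>Meaningful for finite support only: over an infinite support the sum is 0 by convention.
  Finiteness is therefore proved before each evaluation.\<close>

definition second_moment :: "(nat \<Rightarrow> int) \<Rightarrow> int" where
  "second_moment c = (\<Sum>n | c n \<noteq> 0. c n * int n ^ 2)"

lemma second_moment_superset:
  assumes "finite A" "{n. c n \<noteq> 0} \<subseteq> A"
  shows "second_moment c = (\<Sum>n\<in>A. c n * int n ^ 2)"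
  unfolding second_moment_def using assms by (intro sum.mono_neutral_left) auto

lemma finite_support_lincomb:
  assumes "finite {n. c n \<noteq> 0}" "finite {n. d n \<noteq> 0}"
  shows "finite {n. (a * c n + d n :: int) \<noteq> 0}"
  by (rule finite_subset[OF _ finite_UnI[OF assms]]) auto

lemma second_moment_lincomb:
  assumes "finite {n. c n \<noteq> 0}" "finite {n. d n \<noteq> 0}"
  shows "second_moment (\<lambda>n. a * c n + d n) = a * second_moment c + second_moment d"
proof -
  define A where "A = {n. c n \<noteq> 0} \<union> {n. d n \<noteq> 0}"
  have "finite A" using assms by (simp add: A_def)
  note * = second_moment_superset[OF this]
  have "second_moment (\<lambda>n. a * c n + d n) = (\<Sum>n\<in>A. (a * c n + d n) * int n ^ 2)"
    by (rule *) (auto simp: A_def)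
  also have "\<dots> = a * (\<Sum>n\<in>A. c n * int n ^ 2) + (\<Sum>n\<in>A. d n * int n ^ 2)"
    by (simp add: sum.distrib sum_distrib_left algebra_simps)
  also have "(\<Sum>n\<in>A. c n * int n ^ 2) = second_moment c" by (rule *[symmetric]) (auto simp: A_def)
  also have "(\<Sum>n\<in>A. d n * int n ^ 2) = second_moment d" by (rule *[symmetric]) (auto simp: A_def)
  finally show ?thesis .
qed

lemma dilate_support:
  assumes "p > 0"
  shows "{n. dilate p c n \<noteq> 0} = (\<lambda>n. p * n) ` {n. c n \<noteq> 0}"
  using assms by (auto simp: dilate_def)

lemma finite_dilate_support:
  assumes "p > 0"
  shows "finite {n. dilate p c n \<noteq> 0} \<longleftrightarrow> finite {n. c n \<noteq> 0}"
  unfolding dilate_support[OF assms] using assms by (intro finite_image_iff) (auto simp: inj_on_def)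

lemma second_moment_dilate:
  assumes "p > 0"
  shows "second_moment (dilate p c) = int p ^ 2 * second_moment c"
proof -
  have "second_moment (dilate p c) = (\<Sum>n | c n \<noteq> 0. dilate p c (p * n) * int (p * n) ^ 2)"
    unfolding second_moment_def dilate_support[OF assms]
    using assms by (subst sum.reindex) (auto simp: inj_on_def)
  also have "\<dots> = int p ^ 2 * second_moment c"
    using assms unfolding second_moment_def sum_distrib_left
    by (intro sum.cong) (auto simp: dilate_def power2_eq_square)
  finally show ?thesis .
qed

lemma finite_poly_act_support:
  assumes "p > 0" "finite {n. r n \<noteq> 0}"
  shows "finite {n. poly_act p D r n \<noteq> 0}"
proof (induction D)
  case (pCons a D)
  then show ?case
    unfolding poly_act_pCons[OF assms(1)]
    by (intro finite_support_lincomb assms(2)) (simp add: finite_dilate_support assms(1))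
qed simp

lemma second_moment_poly_act:
  assumes "p > 0" "finite {n. r n \<noteq> 0}"
  shows "second_moment (poly_act p D r) = poly D (int p ^ 2) * second_moment r"
proof (induction D)
  case 0
  then show ?case by (simp add: second_moment_def)
next
  case (pCons a D)
  have "second_moment (poly_act p (pCons a D) r) =
      second_moment (\<lambda>n. a * r n + dilate p (poly_act p D r) n)"
    unfolding poly_act_pCons[OF assms(1)] ..
  also have "\<dots> = a * second_moment r + int p ^ 2 * second_moment (poly_act p D r)"
    by (subst second_moment_lincomb)
      (simp_all add: finite_dilate_support finite_poly_act_support second_moment_dilate assms)
  finally show ?case by (simp add: pCons.IH algebra_simps)
qed

section \<open>Divisibility by all powers of \<open>p\<close>, and annihilators of minimal
  degree\<close>

text \<open>The exponent N = |x| already suffices, because |x| < 2^|x| \<le> |q|^|x|. This is the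
  form in which p-adic limits enter the proof.\<close>

lemma int_eq_0_if_powers_dvd:
  fixes x q :: int
  assumes "\<bar>q\<bar> > 1" "\<And>N. q ^ N dvd x"
  shows "x = 0"
proof (rule ccontr)
  assume "x \<noteq> 0"
  have "nat \<bar>x\<bar> < 2 ^ nat \<bar>x\<bar>" by simp
  then have "\<bar>x\<bar> < 2 ^ nat \<bar>x\<bar>"
    by (metis abs_ge_zero int_nat_eq of_nat_less_iff of_nat_numeral of_nat_power)
  also have "(2::int) ^ nat \<bar>x\<bar> \<le> \<bar>q\<bar> ^ nat \<bar>x\<bar>" using assms(1) by (intro power_mono) auto
  also have "\<dots> \<le> \<bar>x\<bar>"
    using dvd_imp_le_int[OF \<open>x \<noteq> 0\<close> assms(2)[of "nat \<bar>x\<bar>"]] by (simp add: power_abs)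
  finally show False by simp
qed

text \<open>If \<open>D = (X - p\<^sup>2) E\<close> and \<open>e = poly_act p E r\<close>, then \<open>e n = p\<^sup>2 * e (p * n)\<close> for all large
  \<open>n\<close>, so that \<open>e n\<close> is divisible by every power of \<open>p\<close> and hence \<open>0\<close>.\<close>

lemma minimal_poly_act_nonroots:
  fixes r :: "nat \<Rightarrow> int"
  assumes p: "p > 1" and D: "D \<noteq> 0" "finite {n. poly_act p D r n \<noteq> 0}"
    and min: "\<And>E. E \<noteq> 0 \<Longrightarrow> finite {n. poly_act p E r n \<noteq> 0} \<Longrightarrow> degree D \<le> degree E"
  shows "coeff D 0 \<noteq> 0" "poly D (int p ^ 2) \<noteq> 0"
proof -
  have p0: "p > 0" using p by simp
  show "coeff D 0 \<noteq> 0"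
  proof
    assume "coeff D 0 = 0"
    then obtain E where E: "D = pCons 0 E" by (metis coeff_pCons_0 pCons_cases)
    then have "E \<noteq> 0" using D(1) by auto
    \<comment> \<open>Dilation moves supports along the injection n \<mapsto> p n, so cancelling a
      factor X from \<open>D\<close> preserves finiteness.\<close>
    have "finite {n. poly_act p E r n \<noteq> 0}"
      using D(2) unfolding E poly_act_pCons[OF p0] by (simp add: finite_dilate_support p0)
    from min[OF \<open>E \<noteq> 0\<close> this] show False using E \<open>E \<noteq> 0\<close> by simp
  qed
  show "poly D (int p ^ 2) \<noteq> 0"
  proof
    assume "poly D (int p ^ 2) = 0"
    then obtain E where E: "D = [:- (int p ^ 2), 1:] * E" by (metis poly_eq_0_iff_dvd dvdE)
    then have "E \<noteq> 0" using D(1) by auto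
    have lin: "D = Polynomial.smult (- (int p ^ 2)) E + pCons 0 E" using E by simp
    have act: "poly_act p D r n = dilate p (poly_act p E r) n - int p ^ 2 * poly_act p E r n" for n
      by (subst lin) (simp only: poly_act_add poly_act_smult poly_act_pCons[OF p0])
    obtain B where B: "\<And>n. poly_act p D r n \<noteq> 0 \<Longrightarrow> n \<le> B"
      using D(2) finite_nat_set_iff_bounded_le by auto
    have step: "poly_act p E r n = int p ^ 2 * poly_act p E r (p * n)" if "n > B" for n
    proof -
      have "n \<le> p * n" using p0 by simp
      then have "poly_act p D r (p * n) = 0" using B[of "p * n"] that by linarith
      then show ?thesis using act[of "p * n"] p0 by (simp add: dilate_def)
    qed
    have "poly_act p E r n = 0" if "n > B" for n
    proof (rule int_eq_0_if_powers_dvd)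
      show "\<bar>int p ^ 2\<bar> > 1" using p by (simp add: power2_eq_square less_1_mult)
      show "(int p ^ 2) ^ N dvd poly_act p E r n" for N
        using that
      proof (induction N arbitrary: n)
        case (Suc N)
        have "n \<le> p * n" using p0 by simp
        then have "(int p ^ 2) ^ N dvd poly_act p E r (p * n)"
          using Suc.prems by (intro Suc.IH) linarith
        then show ?case using step[OF Suc.prems] by simp
      qed simp
    qed
    then have "{n. poly_act p E r n \<noteq> 0} \<subseteq> {..B}" by (auto simp flip: not_less)
    then have "finite {n. poly_act p E r n \<noteq> 0}" by (rule finite_subset) simp
    from min[OF \<open>E \<noteq> 0\<close> this] have "degree D \<le> degree E" .
    moreover have "degree D = 1 + degree E"
      unfolding E using \<open>E \<noteq> 0\<close> by (subst degree_mult_eq) auto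
    ultimately show False by simp
  qed
qed

text \<open>Since the constant coefficient is nonzero, \<open>r n\<close> can be solved for in terms
  of \<open>poly_act p D r n\<close> and the values of \<open>r\<close> at n / p^l with l > 0. If
  \<open>p ^ Suc N\<close> does not divide n, then \<open>p ^ N\<close> does not divide such a
  quotient, so the support at level N + 1 is controlled by the one at level N.\<close>

lemma finite_support_off_power:
  fixes r :: "nat \<Rightarrow> int"
  assumes p: "p > 0" and D: "coeff D 0 \<noteq> 0" "finite {n. poly_act p D r n \<noteq> 0}"
  shows "finite {n. \<not> p ^ N dvd n \<and> r n \<noteq> 0}"
proof (induction N)
  case (Suc N)
  let ?A = "{n. \<not> p ^ N dvd n \<and> r n \<noteq> 0}"
  have "{n. \<not> p ^ Suc N dvd n \<and> r n \<noteq> 0} \<subseteq>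
      {n. poly_act p D r n \<noteq> 0} \<union> (\<Union>l\<in>{..degree D}. (\<lambda>n. p ^ l * n) ` ?A)" (is "_ \<subseteq> ?B \<union> ?C")
  proof (intro subsetI UnCI)
    fix n assume n: "n \<in> {n. \<not> p ^ Suc N dvd n \<and> r n \<noteq> 0}" and "n \<notin> ?C"
    have *: "dilate (p ^ Suc l) r n = 0" if "Suc l \<le> degree D" for l
    proof (rule ccontr)
      assume "dilate (p ^ Suc l) r n \<noteq> 0"
      then have d: "p ^ Suc l dvd n" "r (n div p ^ Suc l) \<noteq> 0"
        by (auto simp: dilate_def split: if_splits)
      then obtain m where m: "n = p ^ Suc l * m" by auto
      have "r m \<noteq> 0" using d(2) m p by simp
      moreover have "\<not> p ^ N dvd m"
      proof
        assume "p ^ N dvd m"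
        then have "p * p ^ N dvd p ^ Suc l * m" by (intro mult_dvd_mono) auto
        then show False using n m by simp
      qed
      ultimately have "n \<in> ?C" using m that by blast
      with \<open>n \<notin> ?C\<close> show False by blast
    qed
    have "poly_act p D r n = coeff D 0 * r n +
        (\<Sum>l<degree D. coeff D (Suc l) * dilate (p ^ Suc l) r n)"
      unfolding poly_act_def by (subst sum.atMost_shift) (simp add: dilate_def)
    also have "(\<Sum>l<degree D. coeff D (Suc l) * dilate (p ^ Suc l) r n) = 0"
      by (rule sum.neutral) (use * in auto)
    finally show "n \<in> ?B" using D(1) n by simp
  qed
  then show ?case by (rule finite_subset) (use D(2) Suc.IH in auto)
qed simp

text \<open>The second moment of \<open>poly_act p D r\<close> is approximated \<open>p\<close>-adically by truncating \<open>r\<close> to the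
  arguments that are not divisible by \<open>p ^ N\<close>.\<close>

lemma second_moment_vanishes:
  fixes r :: "nat \<Rightarrow> int"
  assumes p: "p > 1" and D: "coeff D 0 \<noteq> 0" "finite {n. poly_act p D r n \<noteq> 0}"
    and dvd: "\<And>N. int p ^ N dvd (\<Sum>n | \<not> p ^ N dvd n \<and> r n \<noteq> 0. r n * int n ^ 2)"
  shows "second_moment (poly_act p D r) = 0"
proof (rule int_eq_0_if_powers_dvd)
  show "\<bar>int p\<bar> > 1" using p by simp
  fix N
  have p0: "p > 0" using p by simp
  define t where "t n = (if p ^ N dvd n then 0 else r n)" for n
  define u where "u n = r n - t n" for n
  have ft: "finite {n. t n \<noteq> 0}"
    using finite_support_off_power[OF p0 D, of N] by (rule rev_finite_subset) (auto simp: t_def)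
  have act: "poly_act p D u n = poly_act p D r n - poly_act p D t n" for n
    unfolding u_def by (rule poly_act_minus_right)
  \<comment> \<open>The function \<open>u\<close> itself may have infinite support. Its image under
    the action is a difference of two finitely supported functions, so its second moment makes
    sense.\<close>
  have fu: "finite {n. poly_act p D u n \<noteq> 0}"
    by (rule finite_subset[OF _ finite_UnI[OF D(2) finite_poly_act_support[OF p0 ft, of D]]])
      (auto simp: act)
  have dil: "p ^ N dvd n" if "dilate (p ^ l) u n \<noteq> 0" for l n
  proof -
    have "p ^ l dvd n" "u (n div p ^ l) \<noteq> 0"
      using that by (auto simp: dilate_def split: if_splits)
    then have "p ^ l dvd n" "p ^ N dvd n div p ^ l"
      by (auto simp: u_def t_def split: if_splits)
    then show ?thesis by (metis dvd_mult2 dvd_mult_div_cancel mult.commute)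
  qed
  have "p ^ N dvd n" if "poly_act p D u n \<noteq> 0" for n
  proof -
    from that obtain l where "dilate (p ^ l) u n \<noteq> 0"
      unfolding poly_act_def by (metis (no_types, lifting) mult_zero_right sum.neutral)
    then show ?thesis by (rule dil)
  qed
  then have "int p ^ N dvd poly_act p D u n * int n ^ 2" if "poly_act p D u n \<noteq> 0" for n
    using that by (metis dvd_mult dvd_mult2 of_nat_dvd_iff of_nat_power power2_eq_square)
  then have du: "int p ^ N dvd second_moment (poly_act p D u)"
    unfolding second_moment_def by (intro dvd_sum) auto
  have "second_moment t = (\<Sum>n | \<not> p ^ N dvd n \<and> r n \<noteq> 0. r n * int n ^ 2)"
    unfolding second_moment_def by (rule sum.cong) (auto simp: t_def)
  then have dt: "int p ^ N dvd second_moment t" using dvd by simp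
  have "second_moment (poly_act p D r) =
      second_moment (\<lambda>n. 1 * poly_act p D t n + poly_act p D u n)"
    by (simp add: act)
  also have "\<dots> = 1 * second_moment (poly_act p D t) + second_moment (poly_act p D u)"
    by (rule second_moment_lincomb[OF finite_poly_act_support[OF p0 ft] fu])
  also have "second_moment (poly_act p D t) = poly D (int p ^ 2) * second_moment t"
    by (rule second_moment_poly_act[OF p0 ft])
  finally show "int p ^ N dvd second_moment (poly_act p D r)"
    using du dt by simp
qed


subsection \<open>Matrix representations and Schur's lemma\<close>

lemma subspace_vec_iff:
  "VectorSpace.subspace class_ring W (module_vec TYPE(complex) n) \<longleftrightarrow>
     W \<subseteq> carrier_vec n \<and> 0\<^sub>v n \<in> W \<and> (\<forall>v\<in>W. \<forall>w\<in>W. v + w \<in> W) \<and> (\<forall>c. \<forall>v\<in>W. c \<cdot>\<^sub>v v \<in> W)"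
  unfolding VectorSpace.subspace_def submodule_def using vec_vs vec_module
  by (auto simp: module_vec_simps)

lemma irreducible_repD:
  assumes "irreducible_rep G n \<rho>"
    and "W \<subseteq> carrier_vec n" "0\<^sub>v n \<in> W" "\<And>v w. v \<in> W \<Longrightarrow> w \<in> W \<Longrightarrow> v + w \<in> W"
      "\<And>c v. v \<in> W \<Longrightarrow> c \<cdot>\<^sub>v v \<in> W"
    and "\<And>g w. g \<in> carrier G \<Longrightarrow> w \<in> W \<Longrightarrow> \<rho> g *\<^sub>v w \<in> W"
  shows "W = {0\<^sub>v n} \<or> W = carrier_vec n"
proof -
  have "VectorSpace.subspace class_ring W (module_vec TYPE(complex) n)"
    unfolding subspace_vec_iff using assms by blast
  then show ?thesis using assms(1,6) unfolding irreducible_rep_def by blast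
qed

lemma mult_mat_unit_vec:
  assumes "(A :: complex mat) \<in> carrier_mat m n" "j < n"
  shows "A *\<^sub>v unit_vec n j = col A j"
  using assms by (intro eq_vecI) auto

lemma mult_mat_zero_vec:
  assumes "(A :: complex mat) \<in> carrier_mat m n"
  shows "A *\<^sub>v 0\<^sub>v n = 0\<^sub>v m"
  using assms by (intro eq_vecI) auto

lemma mat_trace_mult:
  assumes "A \<in> carrier_mat m n" "B \<in> carrier_mat n m"
  shows "mat_trace (A * B) = (\<Sum>i<m. \<Sum>j<n. A $$ (i, j) * B $$ (j, i))"
  using assms by (auto simp: mat_trace_def scalar_prod_def atLeast0LessThan intro!: sum.cong)

lemma mat_trace_comm:
  assumes "A \<in> carrier_mat m n" "B \<in> carrier_mat n m"
  shows "mat_trace (A * B) = mat_trace (B * A)"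
  unfolding mat_trace_mult[OF assms] mat_trace_mult[OF assms(2,1)]
  by (subst sum.swap) (simp add: mult.commute)

text \<open>The algebraic half of \<open>continuous_rep\<close>; finite quotients are treated as
  groups without a topology.\<close>

definition mat_rep :: "('a, 'b) monoid_scheme \<Rightarrow> nat \<Rightarrow> ('a \<Rightarrow> complex mat) \<Rightarrow> bool" where
  "mat_rep G n \<rho> \<longleftrightarrow> \<rho> \<in> hom G (units_of (ring_mat TYPE(complex) n ()))"

text \<open>Invertibility of the matrices comes for free: the value at the inverse element is the
  inverse matrix.\<close>

lemma mat_repI:
  assumes "group G" "\<And>g. g \<in> carrier G \<Longrightarrow> \<rho> g \<in> carrier_mat n n"
    "\<And>g h. g \<in> carrier G \<Longrightarrow> h \<in> carrier G \<Longrightarrow> \<rho> (g \<otimes>\<^bsub>G\<^esub> h) = \<rho> g * \<rho> h" "\<rho> \<one>\<^bsub>G\<^esub> = 1\<^sub>m n"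
  shows "mat_rep G n \<rho>"
  unfolding mat_rep_def
proof (rule homI)
  interpret group G by fact
  fix g assume g: "g \<in> carrier G"
  have "\<rho> (inv\<^bsub>G\<^esub> g) * \<rho> g = 1\<^sub>m n" "\<rho> g * \<rho> (inv\<^bsub>G\<^esub> g) = 1\<^sub>m n"
    using assms(3)[of g "inv\<^bsub>G\<^esub> g"] assms(3)[of "inv\<^bsub>G\<^esub> g" g] assms(4) g by simp_all
  then show "\<rho> g \<in> carrier (units_of (ring_mat TYPE(complex) n ()))"
    using assms(2) g unfolding units_of_carrier Units_def ring_mat_simps by blast
qed (use assms(3) in \<open>simp add: units_of_mult ring_mat_simps\<close>)

lemma mat_repD:
  assumes "group G" "mat_rep G n \<rho>"
  shows "g \<in> carrier G \<Longrightarrow> \<rho> g \<in> carrier_mat n n"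
    and "g \<in> carrier G \<Longrightarrow> h \<in> carrier G \<Longrightarrow> \<rho> (g \<otimes>\<^bsub>G\<^esub> h) = \<rho> g * \<rho> h"
    and "\<rho> \<one>\<^bsub>G\<^esub> = 1\<^sub>m n"
proof -
  interpret R: ring "ring_mat TYPE(complex) n ()" by (rule ring_mat)
  interpret U: group "units_of (ring_mat TYPE(complex) n ())" by (rule R.units_group)
  have h: "\<rho> \<in> hom G (units_of (ring_mat TYPE(complex) n ()))" using assms(2) by (simp add: mat_rep_def)
  show "g \<in> carrier G \<Longrightarrow> \<rho> g \<in> carrier_mat n n"
    using hom_in_carrier[OF h, of g] by (auto simp: units_of_carrier Units_def ring_mat_simps)
  show "g \<in> carrier G \<Longrightarrow> h \<in> carrier G \<Longrightarrow> \<rho> (g \<otimes>\<^bsub>G\<^esub> h) = \<rho> g * \<rho> h"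
    using hom_mult[OF h, of g h] by (simp add: units_of_mult ring_mat_simps)
  show "\<rho> \<one>\<^bsub>G\<^esub> = 1\<^sub>m n"
    using hom_one[OF h assms(1) U.group_axioms] by (simp add: units_of_one ring_mat_simps)
qed

definition irr_chars :: "('a, 'b) monoid_scheme \<Rightarrow> ('a \<Rightarrow> complex) set" where
  "irr_chars G = {\<phi>. \<exists>n \<rho>. mat_rep G n \<rho> \<and> irreducible_rep G n \<rho> \<and>
                       \<phi> = (\<lambda>g\<in>carrier G. mat_trace (\<rho> g))}"

text \<open>Kernel and image of \<open>T\<close> are invariant. Irreducibility of
  \<open>\<rho>\<close> makes the kernel zero, irreducibility of \<open>\<sigma>\<close> makes the
  image the whole space, and so \<open>T\<close> is invertible.\<close>

lemma Schur_intertwiner: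
  assumes G: "group G" and \<rho>: "mat_rep G n \<rho>" "irreducible_rep G n \<rho>"
    and \<sigma>: "mat_rep G m \<sigma>" "irreducible_rep G m \<sigma>"
    and T: "T \<in> carrier_mat m n" "\<And>g. g \<in> carrier G \<Longrightarrow> \<sigma> g * T = T * \<rho> g"
    and nz: "T \<noteq> 0\<^sub>m m n"
  shows "n = m" "\<exists>S\<in>carrier_mat n m. T * S = 1\<^sub>m m \<and> S * T = 1\<^sub>m n"
proof -
  note r [simp] = mat_repD(1)[OF G \<rho>(1)] and s [simp] = mat_repD(1)[OF G \<sigma>(1)]
  have Tc [simp]: "T *\<^sub>v v \<in> carrier_vec m" if "v \<in> carrier_vec n" for v
    using T(1) that by simp
  have comm: "\<sigma> g *\<^sub>v (T *\<^sub>v v) = T *\<^sub>v (\<rho> g *\<^sub>v v)" if "g \<in> carrier G" "v \<in> carrier_vec n" for g v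
    using T that by (simp flip: assoc_mult_mat_vec[of _ m m _ n] assoc_mult_mat_vec[of _ m n _ n])
  have T0: "T = 0\<^sub>m m n" if "\<And>v. v \<in> carrier_vec n \<Longrightarrow> T *\<^sub>v v = 0\<^sub>v m"
  proof (rule eq_matI)
    fix i j assume "i < dim_row (0\<^sub>m m n :: complex mat)" "j < dim_col (0\<^sub>m m n :: complex mat)"
    then show "T $$ (i, j) = 0\<^sub>m m n $$ (i, j)"
      using that[of "unit_vec n j"] T(1) by (auto simp: mult_mat_unit_vec dest: arg_cong[of _ _ "\<lambda>v. vec_index v i"])
  qed (use T(1) in auto)
  define W where "W = {v \<in> carrier_vec n. T *\<^sub>v v = 0\<^sub>v m}"
  have "W = {0\<^sub>v n} \<or> W = carrier_vec n"
  proof (rule irreducible_repD[OF \<rho>(2)])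
    fix g w assume "g \<in> carrier G" "w \<in> W"
    moreover have "\<sigma> g *\<^sub>v 0\<^sub>v m = 0\<^sub>v m"
      using s[OF \<open>g \<in> carrier G\<close>] by (rule mult_mat_zero_vec)
    ultimately show "\<rho> g *\<^sub>v w \<in> W" using comm[of g w] T(1) unfolding W_def
      by (auto intro!: mult_mat_vec_carrier[OF r])
  qed (use T(1) in \<open>auto simp: W_def mult_add_distrib_mat_vec mult_mat_vec\<close>)
  then have inj: "v = 0\<^sub>v n" if "v \<in> carrier_vec n" "T *\<^sub>v v = 0\<^sub>v m" for v
    using that T0 nz unfolding W_def by blast
  define U where "U = (\<lambda>v. T *\<^sub>v v) ` carrier_vec n"
  have "U = {0\<^sub>v m} \<or> U = carrier_vec m"
  proof (rule irreducible_repD[OF \<sigma>(2)])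
    show "0\<^sub>v m \<in> U" unfolding U_def using T(1) by (intro image_eqI[of _ _ "0\<^sub>v n"]) auto
    show "v + w \<in> U" if "v \<in> U" "w \<in> U" for v w
    proof -
      from that obtain x y where "v = T *\<^sub>v x" "w = T *\<^sub>v y" "x \<in> carrier_vec n" "y \<in> carrier_vec n"
        unfolding U_def by blast
      then show ?thesis unfolding U_def using T(1)
        by (intro image_eqI[of _ _ "x + y"]) (auto simp: mult_add_distrib_mat_vec)
    qed
    show "c \<cdot>\<^sub>v v \<in> U" if "v \<in> U" for c v
    proof -
      from that obtain x where "v = T *\<^sub>v x" "x \<in> carrier_vec n" unfolding U_def by blast
      then show ?thesis unfolding U_def using T(1)
        by (intro image_eqI[of _ _ "c \<cdot>\<^sub>v x"]) (auto simp: mult_mat_vec)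
    qed
    show "\<sigma> g *\<^sub>v v \<in> U" if g: "g \<in> carrier G" and "v \<in> U" for g v
    proof -
      from that obtain x where "v = T *\<^sub>v x" "x \<in> carrier_vec n" unfolding U_def by blast
      then show ?thesis unfolding U_def
        by (intro image_eqI[of _ _ "\<rho> g *\<^sub>v x"]) (auto simp: comm g intro!: mult_mat_vec_carrier[OF r])
    qed
  qed (auto simp: U_def)
  then have "U = carrier_vec m" using T0 nz unfolding U_def by blast
  then have "\<forall>w\<in>carrier_vec m. \<exists>v\<in>carrier_vec n. T *\<^sub>v v = w" unfolding U_def by (metis imageE)
  then obtain f where f: "\<And>w. w \<in> carrier_vec m \<Longrightarrow> f w \<in> carrier_vec n \<and> T *\<^sub>v f w = w"
    by metis
  \<comment> \<open>The columns of \<open>S\<close> are chosen preimages of the unit vectors, which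
    makes it a right inverse by construction. That it is also a left inverse follows from
    injectivity of \<open>T\<close>.\<close>
  define S where "S = mat n m (\<lambda>(i, j). f (unit_vec m j) $ i)"
  have S: "S \<in> carrier_mat n m" by (simp add: S_def)
  have col_S: "col S j = f (unit_vec m j)" if "j < m" for j
    using that f[of "unit_vec m j"] by (intro eq_vecI) (auto simp: S_def)
  have TS: "T * S = 1\<^sub>m m"
  proof (rule mat_col_eqI)
    fix j assume "j < dim_col (1\<^sub>m m :: complex mat)"
    then show "col (T * S) j = col (1\<^sub>m m) j"
      using T(1) S f[of "unit_vec m j"] by (subst col_mult2[of _ m n _ m]) (auto simp: col_S)
  qed (use T(1) S in auto)
  have ST: "S * T = 1\<^sub>m n"
  proof (rule mat_col_eqI)
    fix j assume "j < dim_col (1\<^sub>m n :: complex mat)"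
    then have j: "j < n" by simp
    let ?d = "col (S * T) j - unit_vec n j"
    have "T *\<^sub>v (S *\<^sub>v col T j) = (T * S) *\<^sub>v col T j"
      using T(1) S j by (intro assoc_mult_mat_vec[symmetric]) auto
    then have "T *\<^sub>v col (S * T) j = col T j"
      using T(1) S j by (subst col_mult2[of _ n m _ n]) (auto simp: TS)
    then have "T *\<^sub>v ?d = 0\<^sub>v m"
      using T(1) S j by (subst mult_minus_distrib_mat_vec[of _ m n]) (auto simp: mult_mat_unit_vec)
    then have "?d = 0\<^sub>v n" using T(1) S by (intro inj) (auto intro!: carrier_vecI)
    have "col (S * T) j = unit_vec n j"
    proof (rule eq_vecI)
      fix i assume "i < dim_vec (unit_vec n j :: complex vec)"
      then show "vec_index (col (S * T) j) i = vec_index (unit_vec n j) i"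
        using arg_cong[OF \<open>?d = 0\<^sub>v n\<close>, of "\<lambda>v. vec_index v i"] S T(1) by (simp del: index_mult_mat col_mult2)
    qed (use S in auto)
    then show "col (S * T) j = col (1\<^sub>m n) j" using j by simp
  qed (use T(1) S in auto)
  show "\<exists>S\<in>carrier_mat n m. T * S = 1\<^sub>m m \<and> S * T = 1\<^sub>m n" using S TS ST by blast
  \<comment> \<open>Equality of the dimensions is read off the traces of T S and S T, which agree
    and equal m and n.\<close>
  have "mat_trace (1\<^sub>m m) = mat_trace (1\<^sub>m n)" using mat_trace_comm[OF T(1) S] TS ST by simp
  then show "n = m" by (simp add: mat_trace_def)
qed

text \<open>A complex matrix of positive size has an eigenvalue c. Then T - c commutes with the
  representation but kills an eigenvector, so it is not invertible and has to be 0.\<close>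

lemma Schur_scalar:
  assumes G: "group G" and \<rho>: "mat_rep G n \<rho>" "irreducible_rep G n \<rho>"
    and T: "T \<in> carrier_mat n n" "\<And>g. g \<in> carrier G \<Longrightarrow> \<rho> g * T = T * \<rho> g"
  shows "\<exists>c. T = c \<cdot>\<^sub>m 1\<^sub>m n"
proof -
  have n: "n > 0" using \<rho>(2) by (simp add: irreducible_rep_def)
  obtain c where "eigenvalue T c"
    using spectrum_non_empty[OF T(1)] n unfolding spectrum_def by blast
  then obtain v where v: "v \<in> carrier_vec n" "v \<noteq> 0\<^sub>v n" "T *\<^sub>v v = c \<cdot>\<^sub>v v"
    using T(1) unfolding eigenvalue_def eigenvector_def by auto
  define Z where "Z = T - (c \<cdot>\<^sub>m 1\<^sub>m n)"
  have Z: "Z \<in> carrier_mat n n" using T(1) by (auto simp: Z_def)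
  have "Z = 0\<^sub>m n n"
  proof (rule ccontr)
    assume nz: "Z \<noteq> 0\<^sub>m n n"
    have "\<rho> g * Z = Z * \<rho> g" if g: "g \<in> carrier G" for g
      using mat_repD(1)[OF G \<rho>(1) g] T(1) T(2)[OF g]
      by (simp add: Z_def mult_minus_distrib_mat[of _ n n] minus_mult_distrib_mat[of _ n n]
          mult_smult_distrib[of _ n n _ n] mult_smult_assoc_mat[of _ n n _ n])
    from Schur_intertwiner(2)[OF G \<rho> \<rho> Z this nz] obtain S where S: "S \<in> carrier_mat n n" "S * Z = 1\<^sub>m n"
      by blast
    have "(c \<cdot>\<^sub>m 1\<^sub>m n) *\<^sub>v v = c \<cdot>\<^sub>v v"
      using v(1) by (intro eq_vecI) auto
    then have "Z *\<^sub>v v = 0\<^sub>v n"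
      using T(1) v by (simp add: Z_def minus_mult_distrib_mat_vec[of _ n n])
    then have "(S * Z) *\<^sub>v v = 0\<^sub>v n"
      using S(1) Z v(1) assoc_mult_mat_vec[OF S(1) Z v(1)] mult_mat_zero_vec[OF S(1)] by simp
    then show False using v S(2) by simp
  qed
  moreover have "T = Z + (c \<cdot>\<^sub>m 1\<^sub>m n)" using T(1) by (auto simp: Z_def)
  ultimately have "T = c \<cdot>\<^sub>m 1\<^sub>m n" by simp
  then show ?thesis by blast
qed


section \<open>Orthogonality of irreducible characters\<close>

text \<open>The inverse element replaces complex conjugation, so unitarity plays no part, and the
  factor 1/|G| is omitted. The norm of an irreducible character is thus |G|.\<close>

definition char_inner :: "('a, 'b) monoid_scheme \<Rightarrow> ('a \<Rightarrow> complex) \<Rightarrow> ('a \<Rightarrow> complex) \<Rightarrow> complex" where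
  "char_inner G \<phi> \<psi> = (\<Sum>g\<in>carrier G. \<phi> g * \<psi> (inv\<^bsub>G\<^esub> g))"

text \<open>The sum over the group of \<open>\<sigma> g * E * \<rho> (inv g)\<close> for the matrix unit \<open>E\<close> at \<open>(k, l)\<close>.\<close>

definition averaged_unit ::
  "('a, 'b) monoid_scheme \<Rightarrow> nat \<Rightarrow> nat \<Rightarrow> ('a \<Rightarrow> complex mat) \<Rightarrow> ('a \<Rightarrow> complex mat) \<Rightarrow> nat \<Rightarrow> nat \<Rightarrow> complex mat"
where
  "averaged_unit G m n \<sigma> \<rho> k l =
     mat m n (\<lambda>(i, j). \<Sum>g\<in>carrier G. \<sigma> g $$ (i, k) * \<rho> (inv\<^bsub>G\<^esub> g) $$ (l, j))"

lemma index_mult_carrier: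
  assumes "A \<in> carrier_mat m n" "B \<in> carrier_mat n q" "i < m" "j < q"
  shows "(A * B) $$ (i, j) = (\<Sum>k<n. A $$ (i, k) * B $$ (k, j))"
  using assms by (auto simp: scalar_prod_def atLeast0LessThan intro!: sum.cong)

text \<open>Replacing g by h^(-1) g in the average moves the factor \<open>\<sigma> h\<close> on the
  left over to a factor \<open>\<rho> h\<close> on the right. The proof does this entry by
  entry.\<close>

lemma averaged_unit_intertwines:
  assumes G: "group G" and \<rho>: "mat_rep G n \<rho>" and \<sigma>: "mat_rep G m \<sigma>"
    and k: "k < m" and l: "l < n" and h: "h \<in> carrier G"
  shows "\<sigma> h * averaged_unit G m n \<sigma> \<rho> k l = averaged_unit G m n \<sigma> \<rho> k l * \<rho> h" (is "_ * ?T = _")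
proof (rule eq_matI)
  interpret group G by fact
  note r = mat_repD[OF G \<rho>] and s = mat_repD[OF G \<sigma>]
  have T: "?T \<in> carrier_mat m n" by (simp add: averaged_unit_def)
  fix i j assume "i < dim_row (?T * \<rho> h)" "j < dim_col (?T * \<rho> h)"
  then have i: "i < m" and j: "j < n" using T r(1)[OF h] by auto
  have cancel: "h \<otimes>\<^bsub>G\<^esub> (inv\<^bsub>G\<^esub> h \<otimes>\<^bsub>G\<^esub> g) = g" "inv\<^bsub>G\<^esub> h \<otimes>\<^bsub>G\<^esub> (h \<otimes>\<^bsub>G\<^esub> g) = g" if "g \<in> carrier G" for g
    using h that m_assoc[of h "inv\<^bsub>G\<^esub> h" g] m_assoc[of "inv\<^bsub>G\<^esub> h" h g] by simp_all
  have "(\<sigma> h * ?T) $$ (i, j) =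
      (\<Sum>c<m. \<Sum>g\<in>carrier G. \<sigma> h $$ (i, c) * (\<sigma> g $$ (c, k) * \<rho> (inv\<^bsub>G\<^esub> g) $$ (l, j)))"
    using i j by (subst index_mult_carrier[OF s(1)[OF h] T])
      (simp_all add: averaged_unit_def sum_distrib_left)
  also have "\<dots> = (\<Sum>g\<in>carrier G. (\<Sum>c<m. \<sigma> h $$ (i, c) * \<sigma> g $$ (c, k)) * \<rho> (inv\<^bsub>G\<^esub> g) $$ (l, j))"
    by (subst sum.swap) (simp add: sum_distrib_right mult.assoc)
  also have "\<dots> = (\<Sum>g\<in>carrier G. \<sigma> (h \<otimes>\<^bsub>G\<^esub> g) $$ (i, k) * \<rho> (inv\<^bsub>G\<^esub> g) $$ (l, j))"
    using i k h by (intro sum.cong refl)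
      (simp add: s(2) index_mult_carrier[OF s(1) s(1)])
  also have "\<dots> = (\<Sum>g\<in>carrier G. \<sigma> g $$ (i, k) * \<rho> (inv\<^bsub>G\<^esub> g \<otimes>\<^bsub>G\<^esub> h) $$ (l, j))"
    using h cancel by (intro sum.reindex_bij_witness[of _ "\<lambda>g. inv\<^bsub>G\<^esub> h \<otimes>\<^bsub>G\<^esub> g" "\<lambda>g. h \<otimes>\<^bsub>G\<^esub> g"])
      (simp_all add: inv_mult_group m_assoc)
  also have "\<dots> = (\<Sum>g\<in>carrier G. \<sigma> g $$ (i, k) * (\<Sum>c<n. \<rho> (inv\<^bsub>G\<^esub> g) $$ (l, c) * \<rho> h $$ (c, j)))"
    using l j h by (intro sum.cong refl)
      (simp add: r(2) index_mult_carrier[OF r(1) r(1)])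
  also have "\<dots> = (\<Sum>c<n. \<Sum>g\<in>carrier G. \<sigma> g $$ (i, k) * \<rho> (inv\<^bsub>G\<^esub> g) $$ (l, c) * \<rho> h $$ (c, j))"
    by (subst sum.swap) (simp add: sum_distrib_left mult.assoc)
  also have "\<dots> = (?T * \<rho> h) $$ (i, j)"
    using i j by (subst index_mult_carrier[OF T r(1)[OF h]])
      (simp_all add: averaged_unit_def sum_distrib_right)
  finally show "(\<sigma> h * ?T) $$ (i, j) = (?T * \<rho> h) $$ (i, j)" .
qed (use mat_repD(1)[OF G \<rho> h] mat_repD(1)[OF G \<sigma> h] in \<open>auto simp: averaged_unit_def\<close>)

text \<open>The product of the two traces is the sum of the products of diagonal entries (i, i) and
  (j, j), and each such product is the (i, j) entry of the summand for the matrix unit at (i, j).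
  This makes Schur's lemma applicable to inner products.\<close>

lemma char_inner_eq_averaged_unit:
  assumes G: "group G" and \<rho>: "mat_rep G n \<rho>" and \<sigma>: "mat_rep G m \<sigma>"
  shows "char_inner G (\<lambda>g\<in>carrier G. mat_trace (\<sigma> g)) (\<lambda>g\<in>carrier G. mat_trace (\<rho> g)) =
    (\<Sum>i<m. \<Sum>j<n. averaged_unit G m n \<sigma> \<rho> i j $$ (i, j))"
proof -
  interpret group G by fact
  note r = mat_repD[OF G \<rho>] and s = mat_repD[OF G \<sigma>]
  have tr: "mat_trace (\<sigma> g) = (\<Sum>i<m. \<sigma> g $$ (i, i))" "mat_trace (\<rho> g) = (\<Sum>i<n. \<rho> g $$ (i, i))"
    if "g \<in> carrier G" for g
    using r(1)[OF that] s(1)[OF that] by (simp_all add: mat_trace_def)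
  have "char_inner G (\<lambda>g\<in>carrier G. mat_trace (\<sigma> g)) (\<lambda>g\<in>carrier G. mat_trace (\<rho> g)) =
      (\<Sum>g\<in>carrier G. (\<Sum>i<m. \<sigma> g $$ (i, i)) * (\<Sum>j<n. \<rho> (inv\<^bsub>G\<^esub> g) $$ (j, j)))"
    unfolding char_inner_def by (rule sum.cong) (simp_all add: tr)
  also have "\<dots> = (\<Sum>g\<in>carrier G. \<Sum>i<m. \<Sum>j<n. \<sigma> g $$ (i, i) * \<rho> (inv\<^bsub>G\<^esub> g) $$ (j, j))"
    by (simp add: sum_product)
  also have "\<dots> = (\<Sum>i<m. \<Sum>j<n. \<Sum>g\<in>carrier G. \<sigma> g $$ (i, i) * \<rho> (inv\<^bsub>G\<^esub> g) $$ (j, j))"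
    by (subst sum.swap) (rule sum.cong[OF refl], rule sum.swap)
  also have "\<dots> = (\<Sum>i<m. \<Sum>j<n. averaged_unit G m n \<sigma> \<rho> i j $$ (i, j))"
    by (simp add: averaged_unit_def)
  finally show ?thesis .
qed

text \<open>A nonzero averaged matrix would be an invertible intertwiner and would force equal
  traces. Working with distinct characters avoids any notion of equivalent representations.\<close>

lemma irr_chars_orthogonal:
  assumes G: "group G" and "\<phi> \<in> irr_chars G" "\<psi> \<in> irr_chars G" "\<phi> \<noteq> \<psi>"
  shows "char_inner G \<phi> \<psi> = 0"
proof -
  interpret group G by fact
  obtain m \<sigma> where \<sigma>: "mat_rep G m \<sigma>" "irreducible_rep G m \<sigma>"
    and \<phi>: "\<phi> = (\<lambda>g\<in>carrier G. mat_trace (\<sigma> g))" using assms(2) unfolding irr_chars_def by blast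
  obtain n \<rho> where \<rho>: "mat_rep G n \<rho>" "irreducible_rep G n \<rho>"
    and \<psi>: "\<psi> = (\<lambda>g\<in>carrier G. mat_trace (\<rho> g))" using assms(3) unfolding irr_chars_def by blast
  note r = mat_repD[OF G \<rho>(1)] and s = mat_repD[OF G \<sigma>(1)]
  have "averaged_unit G m n \<sigma> \<rho> k l = 0\<^sub>m m n" if kl: "k < m" "l < n" for k l
  proof (rule ccontr)
    let ?T = "averaged_unit G m n \<sigma> \<rho> k l"
    assume nz: "?T \<noteq> 0\<^sub>m m n"
    have T: "?T \<in> carrier_mat m n" by (simp add: averaged_unit_def)
    note it = averaged_unit_intertwines[OF G \<rho>(1) \<sigma>(1) kl]
    note S = Schur_intertwiner[OF G \<rho> \<sigma> T it nz]
    obtain S where S: "S \<in> carrier_mat n m" "?T * S = 1\<^sub>m m" "S * ?T = 1\<^sub>m n" using S(2) by blast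
    have "mat_trace (\<sigma> g) = mat_trace (\<rho> g)" if g: "g \<in> carrier G" for g
    proof -
      have "\<sigma> g = \<sigma> g * (?T * S)" using s(1)[OF g] S by simp
      also have "\<dots> = \<sigma> g * ?T * S" using s(1)[OF g] T S(1) by simp
      also have "\<dots> = ?T * (\<rho> g * S)" using r(1)[OF g] T S(1) unfolding it[OF g] by simp
      finally have "mat_trace (\<sigma> g) = mat_trace (\<rho> g * S * ?T)"
        using mat_trace_comm[OF T, of "\<rho> g * S"] r(1)[OF g] S(1) by simp
      also have "\<rho> g * S * ?T = \<rho> g * (S * ?T)" using r(1)[OF g] T S(1) by simp
      finally show ?thesis using S(3) r(1)[OF g] by simp
    qed
    then have "\<phi> = \<psi>" unfolding \<phi> \<psi> by (intro restrict_ext) simp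
    with assms(4) show False ..
  qed
  then show ?thesis unfolding \<phi> \<psi> char_inner_eq_averaged_unit[OF G \<rho>(1) \<sigma>(1)] by simp
qed

text \<open>By Schur each averaged matrix is a scalar, which its trace determines: the trace is |G|
  for k = l and 0 otherwise. The n diagonal pairs then contribute |G|/n each.\<close>

lemma irr_chars_norm:
  assumes G: "group G" and fin: "finite (carrier G)" and "\<phi> \<in> irr_chars G"
  shows "char_inner G \<phi> \<phi> = of_nat (order G)"
proof -
  interpret group G by fact
  obtain n \<rho> where \<rho>: "mat_rep G n \<rho>" "irreducible_rep G n \<rho>"
    and \<phi>: "\<phi> = (\<lambda>g\<in>carrier G. mat_trace (\<rho> g))" using assms(3) unfolding irr_chars_def by blast
  note r = mat_repD[OF G \<rho>(1)]
  have n: "n > 0" using \<rho>(2) by (simp add: irreducible_rep_def)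
  have *: "averaged_unit G n n \<rho> \<rho> k l $$ (k, l) = (if k = l then of_nat (order G) / of_nat n else 0)"
    if kl: "k < n" "l < n" for k l
  proof -
    let ?T = "averaged_unit G n n \<rho> \<rho> k l"
    have T: "?T \<in> carrier_mat n n" by (simp add: averaged_unit_def)
    obtain c where c: "?T = c \<cdot>\<^sub>m 1\<^sub>m n"
      using Schur_scalar[OF G \<rho> T averaged_unit_intertwines[OF G \<rho>(1) \<rho>(1) kl]] by blast
    have "of_nat n * c = mat_trace ?T" unfolding c by (simp add: mat_trace_def)
    also have "\<dots> = (\<Sum>i<n. \<Sum>g\<in>carrier G. \<rho> (inv\<^bsub>G\<^esub> g) $$ (l, i) * \<rho> g $$ (i, k))"
      by (simp add: averaged_unit_def mat_trace_def mult.commute)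
    also have "\<dots> = (\<Sum>g\<in>carrier G. (\<rho> (inv\<^bsub>G\<^esub> g) * \<rho> g) $$ (l, k))"
      using kl by (subst sum.swap) (simp add: index_mult_carrier[OF r(1) r(1)])
    also have "\<dots> = (\<Sum>g\<in>carrier G. (1\<^sub>m n) $$ (l, k))"
      by (intro sum.cong refl) (simp add: r(3) flip: r(2))
    also have "\<dots> = (if k = l then of_nat (order G) else 0)"
      using kl by (auto simp: order_def)
    finally have "c = (if k = l then of_nat (order G) / of_nat n else 0)"
      using n by (auto simp: field_simps split: if_splits)
    moreover have "?T $$ (k, l) = (if k = l then c else 0)" using kl unfolding c by simp
    ultimately show ?thesis by simp
  qed
  have "char_inner G \<phi> \<phi> = (\<Sum>i<n. \<Sum>j<n. averaged_unit G n n \<rho> \<rho> i j $$ (i, j))"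
    unfolding \<phi> by (rule char_inner_eq_averaged_unit[OF G \<rho>(1) \<rho>(1)])
  also have "\<dots> = (\<Sum>i<n. \<Sum>j<n. if i = j then of_nat (order G) / of_nat n else 0)"
    by (intro sum.cong refl) (simp add: *)
  also have "\<dots> = of_nat (order G)" using n by simp
  finally show ?thesis .
qed


subsection \<open>The sum of the squares of the irreducible character degrees\<close>

text \<open>Puts a proper nonzero subspace into coordinate position: a maximal independent subset of
  \<open>W\<close>, extended to a basis of the whole space, gives the columns of \<open>P\<close>,
  and \<open>Q\<close> reads off coordinates. The strict bounds on \<open>r\<close> let an induction
  on the dimension descend to both diagonal blocks.\<close>

lemma adapted_basis:
  fixes W :: "complex vec set"
  assumes W: "W \<subseteq> carrier_vec n" "0\<^sub>v n \<in> W" "\<And>v w. v \<in> W \<Longrightarrow> w \<in> W \<Longrightarrow> v + w \<in> W"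
      "\<And>c v. v \<in> W \<Longrightarrow> c \<cdot>\<^sub>v v \<in> W"
    and proper: "W \<noteq> {0\<^sub>v n}" "W \<noteq> carrier_vec n"
  shows "\<exists>P Q r. P \<in> carrier_mat n n \<and> Q \<in> carrier_mat n n \<and> P * Q = 1\<^sub>m n \<and> Q * P = 1\<^sub>m n \<and>
    0 < r \<and> r < n \<and> (\<forall>j<r. col P j \<in> W) \<and>
    (\<forall>w\<in>W. \<forall>i. r \<le> i \<longrightarrow> i < n \<longrightarrow> vec_index (Q *\<^sub>v w) i = 0)"
proof -
  interpret V: vec_space "TYPE(complex)" n .
  have submod: "submodule class_ring N (module_vec TYPE(complex) n)"
    if "N \<subseteq> carrier_vec n" "0\<^sub>v n \<in> N" "\<And>v w. v \<in> N \<Longrightarrow> w \<in> N \<Longrightarrow> v + w \<in> N"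
      "\<And>c v. v \<in> N \<Longrightarrow> c \<cdot>\<^sub>v v \<in> N" for N
    using subspace_vec_iff[of N n] that unfolding VectorSpace.subspace_def by blast
  have bound: "finite A \<and> card A \<le> n" if "A \<subseteq> carrier_vec n" "V.lin_indpt A" for A
    using V.li_le_dim[of A] that V.dim_is_n by simp
  have "V.lin_indpt {}"
    by (rule V.finite_lin_indpt2) simp_all
  have "\<exists>B. finite B \<and> maximal B (\<lambda>A. A \<subseteq> W \<and> V.lin_indpt A)"
  proof (rule maximal_exists[where B = "{}" and N = n])
    fix A assume "A \<subseteq> W \<and> V.lin_indpt A"
    then show "finite A \<and> card A \<le> n" using W(1) by (intro bound) (blast, simp)
  next
    show "{} \<subseteq> W \<and> V.lin_indpt {}" using \<open>V.lin_indpt {}\<close> by simp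
  qed
  then obtain B where fin_B: "finite B" and max_B: "maximal B (\<lambda>A. A \<subseteq> W \<and> V.lin_indpt A)"
    by (elim exE conjE)
  have B: "finite B" "B \<subseteq> W" "V.lin_indpt B" using fin_B max_B by (simp_all add: maximal_def)
  have Bmax: "A = B" if "B \<subseteq> A" "A \<subseteq> W" "V.lin_indpt A" for A
    using max_B that by (simp add: maximal_def)
  have BC: "B \<subseteq> carrier_vec n" using B W(1) by blast
  have "\<exists>C. finite C \<and> maximal C (\<lambda>A. B \<subseteq> A \<and> A \<subseteq> carrier_vec n \<and> V.lin_indpt A)"
  proof (rule maximal_exists[where B = B and N = n])
    fix A assume "B \<subseteq> A \<and> A \<subseteq> carrier_vec n \<and> V.lin_indpt A"
    then show "finite A \<and> card A \<le> n" by (intro bound) simp_all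
  next
    show "B \<subseteq> B \<and> B \<subseteq> carrier_vec n \<and> V.lin_indpt B" using B BC by simp
  qed
  then obtain C where fin_C: "finite C"
    and max_C: "maximal C (\<lambda>A. B \<subseteq> A \<and> A \<subseteq> carrier_vec n \<and> V.lin_indpt A)"
    by (elim exE conjE)
  have C: "finite C" "B \<subseteq> C" "C \<subseteq> carrier_vec n" "V.lin_indpt C"
    using fin_C max_C by (simp_all add: maximal_def)
  have Cmax: "A = C" if "C \<subseteq> A" "A \<subseteq> carrier_vec n" "V.lin_indpt A" for A
    using max_C that C(2) by (simp add: maximal_def)
  have "V.basis C"
    by (rule V.max_li_is_basis) (use C Cmax in \<open>simp add: maximal_def\<close>)
  then have card_C: "card C = n" using V.dim_basis[OF C(1)] V.dim_is_n by simp
  have W_span: "W \<subseteq> V.span B"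
  proof
    fix w assume w: "w \<in> W"
    show "w \<in> V.span B"
    proof (cases "w \<in> B")
      case True
      then show ?thesis using V.in_own_span[of B] BC by auto
    next
      case False
      then have "V.lin_dep (B \<union> {w})" using Bmax[of "B \<union> {w}"] B w by blast
      then show ?thesis using V.lin_dep_iff_in_span[of B w] B BC False w W(1) by auto
    qed
  qed
  obtain bs where bs: "set bs = B" "distinct bs" using finite_distinct_list[OF B(1)] by blast
  obtain cs where cs: "set cs = C - B" "distinct cs" using finite_distinct_list[of "C - B"] C(1) by blast
  define P where "P = mat_of_cols n (bs @ cs)"
  have dist: "distinct (bs @ cs)" using bs cs by auto
  have set: "set (bs @ cs) = C" using bs cs C(2) by auto
  have len: "length (bs @ cs) = n" using distinct_card[OF dist] set card_C by simp
  have P: "P \<in> carrier_mat n n" unfolding P_def using len mat_of_cols_carrier(1)[of n "bs @ cs"] by simp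
  have cols_P: "cols P = bs @ cs" unfolding P_def by (rule cols_mat_of_cols) (use set C(3) in simp)
  have "V.rank P = n"
    by (rule V.lin_indpt_full_rank[OF P]) (use cols_P dist set C(4) in simp_all)
  then have "Determinant.det P \<noteq> 0" using V.det_rank_iff[OF P] by simp
  then have "P \<in> Units (ring_mat TYPE(complex) n ())" by (rule det_non_zero_imp_unit[OF P])
  then obtain Q where Q: "Q \<in> carrier_mat n n" "P * Q = 1\<^sub>m n" "Q * P = 1\<^sub>m n"
    unfolding Units_def ring_mat_simps by blast
  define r where "r = length bs"
  have col_P: "col P j = bs ! j" if "j < r" for j
  proof -
    have "j < dim_col P" using that len P r_def by simp
    then have "col P j = cols P ! j" by simp
    then show ?thesis using that by (simp add: cols_P nth_append r_def)
  qed
  have card_B: "card B = r" using bs distinct_card r_def by blast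
  have "r > 0"
  proof (rule ccontr)
    assume "\<not> r > 0"
    then have "B = {}" using bs r_def by simp
    then show False using W_span W(2) proper(1) V.span_empty by auto
  qed
  moreover have "r < n"
  proof (rule ccontr)
    assume "\<not> r < n"
    then have "V.basis B" using card_B B BC V.dim_is_n by (intro V.dim_li_is_basis) auto
    then have "V.span B = carrier_vec n" unfolding V.basis_def by simp
    moreover have "V.span B \<subseteq> W" by (rule V.span_is_subset[OF B(2) submod[OF W]])
    ultimately show False using proper(2) W(1) by blast
  qed
  moreover have "\<forall>j<r. col P j \<in> W" using col_P bs B(2) r_def by auto
  moreover have "\<forall>w\<in>W. \<forall>i. r \<le> i \<longrightarrow> i < n \<longrightarrow> vec_index (Q *\<^sub>v w) i = 0"
  proof -
    \<comment> \<open>The vectors whose last n - r coordinates vanish form a subspace. It is enough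
      to find the basis \<open>B\<close> in it, as \<open>W\<close> lies in the span of
      \<open>B\<close>.\<close>
    define N where "N = {w \<in> carrier_vec n. \<forall>i. r \<le> i \<longrightarrow> i < n \<longrightarrow> vec_index (Q *\<^sub>v w) i = 0}"
    have "B \<subseteq> N"
    proof
      fix b assume "b \<in> B"
      then obtain j where j: "j < r" "b = bs ! j" using bs r_def by (metis in_set_conv_nth)
      have "j < n" using j \<open>r < n\<close> by simp
      have "Q *\<^sub>v b = Q *\<^sub>v (P *\<^sub>v unit_vec n j)"
        using col_P[OF j(1)] j(2) mult_mat_unit_vec[OF P \<open>j < n\<close>] by simp
      also have "\<dots> = unit_vec n j"
        using assoc_mult_mat_vec[OF Q(1) P unit_vec_carrier, of j] Q(3) by simp
      finally show "b \<in> N" using j(1) \<open>b \<in> B\<close> BC by (auto simp: N_def)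
    qed
    moreover have "submodule class_ring N (module_vec TYPE(complex) n)"
      by (rule submod) (use Q(1) in \<open>auto simp: N_def mult_mat_zero_vec[OF Q(1)]
        mult_mat_vec[OF Q(1)] scalar_prod_add_distrib[of _ n]\<close>)
    ultimately have "V.span B \<subseteq> N" by (rule V.span_is_subset)
    then show ?thesis using W_span by (auto simp: N_def)
  qed
  ultimately show ?thesis
    by (intro exI[of _ P] exI[of _ Q] exI[of _ r] conjI P Q)
qed

section \<open>Block triangular matrices and the splitting of traces\<close>

definition upper_block :: "nat \<Rightarrow> complex mat \<Rightarrow> complex mat" where
  "upper_block r M = mat r r (\<lambda>(i, j). M $$ (i, j))"

definition lower_block :: "nat \<Rightarrow> nat \<Rightarrow> complex mat \<Rightarrow> complex mat" where
  "lower_block r s M = mat s s (\<lambda>(i, j). M $$ (r + i, r + j))"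

lemma sum_lessThan_add: "(\<Sum>k<r + s. f k) = (\<Sum>k<r. f k) + (\<Sum>k<s. f (r + k :: nat) :: complex)"
  by (induction s) (auto simp: add.assoc)

text \<open>In the top left block of A B the extra terms contain a lower left entry of
  \<open>B\<close>, in the bottom right block a lower left entry of \<open>A\<close>; all of these
  are 0.\<close>

lemma block_mult:
  assumes "A \<in> carrier_mat (r + s) (r + s)" "B \<in> carrier_mat (r + s) (r + s)"
    and A: "\<And>i j. i < s \<Longrightarrow> j < r \<Longrightarrow> A $$ (r + i, j) = 0"
    and B: "\<And>i j. i < s \<Longrightarrow> j < r \<Longrightarrow> B $$ (r + i, j) = 0"
  shows "upper_block r (A * B) = upper_block r A * upper_block r B"
    and "lower_block r s (A * B) = lower_block r s A * lower_block r s B"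
proof -
  note * = index_mult_carrier[OF assms(1,2)]
  show "upper_block r (A * B) = upper_block r A * upper_block r B"
  proof (rule eq_matI)
    fix i j
    assume "i < dim_row (upper_block r A * upper_block r B)" "j < dim_col (upper_block r A * upper_block r B)"
    then have "i < r" "j < r" by (auto simp: upper_block_def)
    then show "upper_block r (A * B) $$ (i, j) = (upper_block r A * upper_block r B) $$ (i, j)"
      by (subst index_mult_carrier[of _ r r _ r])
        (simp_all add: upper_block_def * sum_lessThan_add B)
  qed (auto simp: upper_block_def)
  show "lower_block r s (A * B) = lower_block r s A * lower_block r s B"
  proof (rule eq_matI)
    fix i j
    assume "i < dim_row (lower_block r s A * lower_block r s B)" "j < dim_col (lower_block r s A * lower_block r s B)"
    then have "i < s" "j < s" by (auto simp: lower_block_def)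
    then show "lower_block r s (A * B) $$ (i, j) = (lower_block r s A * lower_block r s B) $$ (i, j)"
      by (subst index_mult_carrier[of _ s s _ s])
        (simp_all add: lower_block_def * sum_lessThan_add A)
  qed (auto simp: lower_block_def)
qed

lemma mat_trace_blocks:
  assumes "A \<in> carrier_mat (r + s) (r + s)"
  shows "mat_trace A = mat_trace (upper_block r A) + mat_trace (lower_block r s A)"
  using assms by (simp add: mat_trace_def upper_block_def lower_block_def sum_lessThan_add)

text \<open>No invariant complement is constructed. In a basis adapted to an invariant subspace the
  matrices are block triangular, and the two diagonal blocks are smaller representations that carry
  the whole trace. A list records multiplicities.\<close>

lemma mat_rep_char_decomposition:
  assumes G: "group G" and "mat_rep G n \<rho>"
  shows "\<exists>\<phi>s. set \<phi>s \<subseteq> irr_chars G \<and> (\<forall>g\<in>carrier G. mat_trace (\<rho> g) = (\<Sum>\<phi>\<leftarrow>\<phi>s. \<phi> g))"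
  using assms(2)
proof (induction n arbitrary: \<rho> rule: less_induct)
  case (less n)
  interpret group G by fact
  note r = mat_repD[OF G less.prems]
  consider "n = 0" | "irreducible_rep G n \<rho>" | "n > 0" "\<not> irreducible_rep G n \<rho>" by blast
  then show ?case
  proof cases
    case 1
    then show ?thesis using r(1) by (intro exI[of _ "[]"]) (auto simp: mat_trace_def dest!: r(1))
  next
    case 2
    then have "(\<lambda>g\<in>carrier G. mat_trace (\<rho> g)) \<in> irr_chars G"
      unfolding irr_chars_def using less.prems by blast
    then show ?thesis by (intro exI[of _ "[\<lambda>g\<in>carrier G. mat_trace (\<rho> g)]"]) auto
  next
    case 3
    then obtain W where "VectorSpace.subspace class_ring W (module_vec TYPE(complex) n)"
      and inv: "\<And>g w. g \<in> carrier G \<Longrightarrow> w \<in> W \<Longrightarrow> \<rho> g *\<^sub>v w \<in> W"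
      and proper: "W \<noteq> {0\<^sub>v n}" "W \<noteq> carrier_vec n"
      unfolding irreducible_rep_def by blast
    then have W: "W \<subseteq> carrier_vec n" "0\<^sub>v n \<in> W" "\<And>v w. v \<in> W \<Longrightarrow> w \<in> W \<Longrightarrow> v + w \<in> W"
      "\<And>c v. v \<in> W \<Longrightarrow> c \<cdot>\<^sub>v v \<in> W"
      unfolding subspace_vec_iff by blast+
    from adapted_basis[OF W proper] obtain P Q q where
      P: "P \<in> carrier_mat n n" and Q: "Q \<in> carrier_mat n n" and PQ: "P * Q = 1\<^sub>m n" "Q * P = 1\<^sub>m n"
      and q: "0 < q" "q < n" and PW: "\<And>j. j < q \<Longrightarrow> col P j \<in> W"
      and QW: "\<And>w i. w \<in> W \<Longrightarrow> q \<le> i \<Longrightarrow> i < n \<Longrightarrow> vec_index (Q *\<^sub>v w) i = 0"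
      by blast
    define s where "s = n - q"
    have n: "n = q + s" and s: "s < n" using q by (simp_all add: s_def)
    define M where "M g = Q * (\<rho> g * P)" for g
    have M: "M g \<in> carrier_mat (q + s) (q + s)" if "g \<in> carrier G" for g
      using P Q r(1)[OF that] by (simp add: M_def n)
    \<comment> \<open>For j < q, column j of \<open>M g\<close> holds the coordinates of the image
      under \<open>\<rho> g\<close> of a vector of \<open>W\<close>. This image stays in
      \<open>W\<close>, so its coordinates from q on vanish.\<close>
    have M0: "M g $$ (q + i, j) = 0" if "g \<in> carrier G" "i < s" "j < q" for g i j
    proof -
      have "j < n" "q + i < n" using that q n by auto
      have "col (M g) j = Q *\<^sub>v (\<rho> g *\<^sub>v col P j)"
        unfolding M_def using P Q r(1)[OF that(1)] \<open>j < n\<close>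
        by (simp add: col_mult2[of _ n n _ n] del: col_mult)
      moreover have "M g $$ (q + i, j) = vec_index (col (M g) j) (q + i)"
        using M[OF that(1)] \<open>j < n\<close> \<open>q + i < n\<close> n by auto
      ultimately show ?thesis
        using QW[OF inv[OF that(1) PW[OF that(3)]], of "q + i"] \<open>q + i < n\<close> by simp
    qed
    have M_mult: "M (g \<otimes>\<^bsub>G\<^esub> h) = M g * M h" if "g \<in> carrier G" "h \<in> carrier G" for g h
    proof -
      note c = P Q r(1)[OF that(1)] r(1)[OF that(2)]
      have "M g * M h = Q * (\<rho> g * (P * (Q * (\<rho> h * P))))"
        unfolding M_def using c assoc_mult_mat[of Q n n "\<rho> g * P" n "Q * (\<rho> h * P)" n]
          assoc_mult_mat[of "\<rho> g" n n P n "Q * (\<rho> h * P)" n] by simp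
      also have "P * (Q * (\<rho> h * P)) = P * Q * (\<rho> h * P)"
        using c by (intro assoc_mult_mat[symmetric, of _ n n _ n _ n]) auto
      also have "\<dots> = \<rho> h * P" using c by (simp add: PQ)
      also have "\<rho> g * (\<rho> h * P) = \<rho> (g \<otimes>\<^bsub>G\<^esub> h) * P"
        using assoc_mult_mat[OF c(3,4,1)] by (simp add: r(2)[OF that])
      finally show ?thesis by (simp add: M_def)
    qed
    have M_one: "M \<one>\<^bsub>G\<^esub> = 1\<^sub>m (q + s)" using P PQ by (simp add: M_def r(3) n)
    have tr: "mat_trace (\<rho> g) = mat_trace (upper_block q (M g)) + mat_trace (lower_block q s (M g))"
      if g: "g \<in> carrier G" for g
    proof -
      note c = P Q r(1)[OF g]
      have "mat_trace (M g) = mat_trace (\<rho> g * P * Q)"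
        unfolding M_def using c by (intro mat_trace_comm) auto
      also have "\<rho> g * P * Q = \<rho> g" using c(3) assoc_mult_mat[OF c(3,1,2)] by (simp add: PQ(1))
      finally show ?thesis using mat_trace_blocks[OF M[OF g]] by simp
    qed
    have "mat_rep G q (\<lambda>g. upper_block q (M g))"
    proof (rule mat_repI[OF G])
      show "upper_block q (M (g \<otimes>\<^bsub>G\<^esub> h)) = upper_block q (M g) * upper_block q (M h)"
        if "g \<in> carrier G" "h \<in> carrier G" for g h
        unfolding M_mult[OF that] by (rule block_mult[OF M M M0 M0]) (use that in auto)
    qed (auto simp: M_one upper_block_def)
    from less.IH[OF q(2) this] obtain \<phi>s where \<phi>s: "set \<phi>s \<subseteq> irr_chars G"
      "\<And>g. g \<in> carrier G \<Longrightarrow> mat_trace (upper_block q (M g)) = (\<Sum>\<phi>\<leftarrow>\<phi>s. \<phi> g)" by blast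
    have "mat_rep G s (\<lambda>g. lower_block q s (M g))"
    proof (rule mat_repI[OF G])
      show "lower_block q s (M (g \<otimes>\<^bsub>G\<^esub> h)) = lower_block q s (M g) * lower_block q s (M h)"
        if "g \<in> carrier G" "h \<in> carrier G" for g h
        unfolding M_mult[OF that] by (rule block_mult[OF M M M0 M0]) (use that in auto)
    qed (auto simp: M_one lower_block_def)
    from less.IH[OF s this] obtain \<psi>s where \<psi>s: "set \<psi>s \<subseteq> irr_chars G"
      "\<And>g. g \<in> carrier G \<Longrightarrow> mat_trace (lower_block q s (M g)) = (\<Sum>\<psi>\<leftarrow>\<psi>s. \<psi> g)" by blast
    show ?thesis
      by (intro exI[of _ "\<phi>s @ \<psi>s"]) (use \<phi>s \<psi>s tr in auto)
  qed
qed

section \<open>The regular character and the sum of squares formula\<close>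

text \<open>Permutation matrices of the left translations: a translation by a nontrivial element has
  no fixed point, hence trace 0.\<close>

lemma regular_rep:
  assumes G: "group G" and fin: "finite (carrier G)"
  shows "\<exists>\<rho>. mat_rep G (order G) \<rho> \<and>
    (\<forall>g\<in>carrier G. mat_trace (\<rho> g) = (if g = \<one>\<^bsub>G\<^esub> then of_nat (order G) else 0))"
proof -
  interpret group G by fact
  define N where "N = order G"
  obtain e where e: "bij_betw e {0..<N} (carrier G)"
    using ex_bij_betw_nat_finite[OF fin] unfolding N_def order_def by blast
  have e_in: "e i \<in> carrier G" if "i < N" for i
    using e that by (auto simp: bij_betw_def)
  have e_inj: "e i = e j \<longleftrightarrow> i = j" if "i < N" "j < N" for i j
    using e that by (auto simp: bij_betw_def inj_on_def)
  define \<rho> where "\<rho> g = mat N N (\<lambda>(i, j). if g \<otimes>\<^bsub>G\<^esub> e j = e i then 1 else 0 :: complex)" for g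
  have "mat_rep G N \<rho>"
  proof (rule mat_repI[OF G])
    show "\<rho> g \<in> carrier_mat N N" for g by (simp add: \<rho>_def)
    show "\<rho> \<one>\<^bsub>G\<^esub> = 1\<^sub>m N"
      by (rule eq_matI) (auto simp: \<rho>_def e_in e_inj)
    fix g h assume g: "g \<in> carrier G" and h: "h \<in> carrier G"
    show "\<rho> (g \<otimes>\<^bsub>G\<^esub> h) = \<rho> g * \<rho> h"
    proof (rule eq_matI)
      fix i j assume "i < dim_row (\<rho> g * \<rho> h)" "j < dim_col (\<rho> g * \<rho> h)"
      then have ij: "i < N" "j < N" by (auto simp: \<rho>_def)
      have "h \<otimes>\<^bsub>G\<^esub> e j \<in> e ` {0..<N}" using e h e_in[OF ij(2)] by (simp add: bij_betw_def)
      then obtain k0 where k0: "k0 < N" "h \<otimes>\<^bsub>G\<^esub> e j = e k0" by auto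
      have "(\<rho> g * \<rho> h) $$ (i, j) = (\<Sum>k<N. \<rho> g $$ (i, k) * \<rho> h $$ (k, j))"
        using ij by (intro index_mult_carrier[of _ N N _ N]) (auto simp: \<rho>_def)
      also have "\<dots> = (\<Sum>k<N. if k = k0 then \<rho> g $$ (i, k0) else 0)"
        using ij k0 by (intro sum.cong refl) (auto simp: \<rho>_def e_inj)
      also have "\<dots> = \<rho> g $$ (i, k0)" using k0 by simp
      also have "\<dots> = \<rho> (g \<otimes>\<^bsub>G\<^esub> h) $$ (i, j)"
        using ij k0 g h e_in[OF ij(2)] by (simp add: \<rho>_def m_assoc)
      finally show "\<rho> (g \<otimes>\<^bsub>G\<^esub> h) $$ (i, j) = (\<rho> g * \<rho> h) $$ (i, j)" by simp
    qed (auto simp: \<rho>_def)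
  qed
  moreover have "mat_trace (\<rho> g) = (if g = \<one>\<^bsub>G\<^esub> then of_nat N else 0)" if g: "g \<in> carrier G" for g
  proof -
    have "mat_trace (\<rho> g) = (\<Sum>i<N. if g = \<one>\<^bsub>G\<^esub> then 1 else 0)"
      unfolding mat_trace_def using g e_in
      by (intro sum.cong) (auto simp: \<rho>_def)
    then show ?thesis by simp
  qed
  ultimately show ?thesis unfolding N_def by blast
qed

lemma irr_chars_degree:
  assumes "group G" "\<phi> \<in> irr_chars G"
  shows "\<exists>n>0. \<phi> \<one>\<^bsub>G\<^esub> = of_nat n"
proof -
  interpret group G by fact
  obtain n \<rho> where r: "mat_rep G n \<rho>" "irreducible_rep G n \<rho>"
    and \<phi>: "\<phi> = (\<lambda>g\<in>carrier G. mat_trace (\<rho> g))"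
    using assms(2) unfolding irr_chars_def by blast
  have "\<phi> \<one>\<^bsub>G\<^esub> = of_nat n"
    using mat_repD(3)[OF assms(1) r(1)] by (simp add: \<phi> mat_trace_def)
  then show ?thesis using r(2) unfolding irreducible_rep_def by blast
qed

lemma sum_list_count: "(\<Sum>x\<leftarrow>xs. f x) = (\<Sum>x\<in>set xs. of_nat (count_list xs x) * f x :: 'b :: comm_semiring_1)"
proof (induction xs)
  case (Cons a xs)
  have *: "(\<Sum>x\<in>set (a # xs). of_nat (count_list xs x) * f x) = (\<Sum>x\<in>set xs. of_nat (count_list xs x) * f x)"
    by (rule sum.mono_neutral_right) (auto simp: count_list_0_iff)
  have "(\<Sum>x\<in>set (a # xs). of_nat (count_list (a # xs) x) * f x) =
      (\<Sum>x\<in>set (a # xs). (if x = a then f x else 0) + of_nat (count_list xs x) * f x)"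
    by (intro sum.cong) (auto simp: algebra_simps)
  also have "\<dots> = f a + (\<Sum>x\<in>set xs. of_nat (count_list xs x) * f x)"
    unfolding sum.distrib * by simp
  finally show ?case using Cons.IH by simp
qed simp

text \<open>Pairing the regular character with an irreducible \<phi> gives |G| \<phi>(1) on one side
  and |G| times the multiplicity of \<phi> on the other. Each irreducible character thus occurs as
  often as its degree, and evaluation at the identity gives the formula.\<close>

theorem irr_chars_sum_squares:
  assumes G: "group G" and fin: "finite (carrier G)"
  shows "finite (irr_chars G)" "(\<Sum>\<phi>\<in>irr_chars G. \<phi> \<one>\<^bsub>G\<^esub> ^ 2) = of_nat (order G)"
proof -
  interpret group G by fact
  have N: "order G > 0" using fin order_gt_0_iff_finite by blast
  obtain \<rho> where \<rho>: "mat_rep G (order G) \<rho>"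
    "\<And>g. g \<in> carrier G \<Longrightarrow> mat_trace (\<rho> g) = (if g = \<one>\<^bsub>G\<^esub> then of_nat (order G) else 0)"
    using regular_rep[OF G fin] by blast
  obtain \<phi>s where \<phi>s: "set \<phi>s \<subseteq> irr_chars G"
    and reg: "\<And>g. g \<in> carrier G \<Longrightarrow> mat_trace (\<rho> g) = (\<Sum>\<phi>\<leftarrow>\<phi>s. \<phi> g)"
    using mat_rep_char_decomposition[OF G \<rho>(1)] by blast
  have deg: "of_nat (count_list \<phi>s \<phi>) = \<phi> \<one>\<^bsub>G\<^esub>" if \<phi>: "\<phi> \<in> irr_chars G" for \<phi>
  proof -
    have "of_nat (order G) * \<phi> \<one>\<^bsub>G\<^esub> = (\<Sum>g\<in>carrier G. if g = \<one>\<^bsub>G\<^esub> then of_nat (order G) * \<phi> \<one>\<^bsub>G\<^esub> else 0)"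
      using fin by simp
    also have "\<dots> = (\<Sum>g\<in>carrier G. (\<Sum>\<psi>\<leftarrow>\<phi>s. \<psi> g) * \<phi> (inv\<^bsub>G\<^esub> g))"
      by (intro sum.cong refl) (simp add: \<rho>(2) flip: reg)
    also have "\<dots> = (\<Sum>\<psi>\<in>set \<phi>s. of_nat (count_list \<phi>s \<psi>) * char_inner G \<psi> \<phi>)"
      unfolding sum_list_count char_inner_def sum_distrib_right sum_distrib_left mult.assoc
      by (rule sum.swap)
    also have "\<dots> = (\<Sum>\<psi>\<in>set \<phi>s. if \<psi> = \<phi> then of_nat (count_list \<phi>s \<phi>) * of_nat (order G) else 0)"
      using \<phi>s \<phi> irr_chars_orthogonal[OF G] irr_chars_norm[OF G fin]
      by (intro sum.cong refl) auto
    also have "\<dots> = of_nat (count_list \<phi>s \<phi>) * of_nat (order G)"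
      by (cases "\<phi> \<in> set \<phi>s") (auto simp: count_list_0_iff)
    finally show ?thesis using N by simp
  qed
  \<comment> \<open>Degrees are positive, so every irreducible character appears in the finite list;
    this is where finiteness comes from.\<close>
  have "irr_chars G \<subseteq> set \<phi>s"
  proof
    fix \<phi> assume \<phi>: "\<phi> \<in> irr_chars G"
    then have "count_list \<phi>s \<phi> \<noteq> 0" using deg[OF \<phi>] irr_chars_degree[OF G \<phi>] by (metis less_nat_zero_code of_nat_eq_iff)
    then show "\<phi> \<in> set \<phi>s" by (metis count_list_0_iff)
  qed
  with \<phi>s have eq: "irr_chars G = set \<phi>s" by blast
  then show "finite (irr_chars G)" by simp
  have "of_nat (order G) = (\<Sum>\<phi>\<leftarrow>\<phi>s. \<phi> \<one>\<^bsub>G\<^esub>)" using \<rho>(2)[of "\<one>\<^bsub>G\<^esub>"] reg[of "\<one>\<^bsub>G\<^esub>"] by simp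
  also have "\<dots> = (\<Sum>\<phi>\<in>irr_chars G. of_nat (count_list \<phi>s \<phi>) * \<phi> \<one>\<^bsub>G\<^esub>)"
    unfolding eq by (rule sum_list_count)
  also have "\<dots> = (\<Sum>\<phi>\<in>irr_chars G. \<phi> \<one>\<^bsub>G\<^esub> ^ 2)"
    by (intro sum.cong refl) (simp add: deg power2_eq_square)
  finally show "(\<Sum>\<phi>\<in>irr_chars G. \<phi> \<one>\<^bsub>G\<^esub> ^ 2) = of_nat (order G)" by simp
qed


subsection \<open>Open normal subgroups of profinite groups\<close>

context topological_group begin

lemma continuous_map_mult:
  assumes "continuous_map Y T f" "continuous_map Y T g"
  shows "continuous_map Y T (\<lambda>x. f x \<otimes> g x)"
  using continuous_map_compose[OF continuous_map_pairedI[OF assms] continuous_mult]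
  by (simp add: comp_def)

lemma openin_r_coset:
  assumes "subgroup K G" "openin T K" "g \<in> carrier G"
  shows "openin T (K #> g)"
proof -
  have "continuous_map T T (\<lambda>x. x \<otimes> inv g)"
    using assms(3) by (intro continuous_map_mult) (simp_all add: topspace_eq)
  from openin_continuous_map_preimage[OF this assms(2)]
  have "openin T {x \<in> carrier G. x \<otimes> inv g \<in> K}" by (simp add: topspace_eq)
  also have "{x \<in> carrier G. x \<otimes> inv g \<in> K} = K #> g"
    using assms(3) subgroup.subset[OF assms(1)]
    by (auto simp: r_coset_def m_assoc intro!: bexI[of _ "_ \<otimes> inv g"])
  finally show ?thesis .
qed

end

context profinite_group begin

text \<open>In a compact Hausdorff space the connected component of x is the intersection of the
  clopen sets around x, and here it is a single point. Compactness of the complement of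
  \<open>V\<close> reduces this intersection to finitely many sets.\<close>

lemma clopen_neighbourhood:
  assumes "openin T V" "x \<in> V"
  shows "\<exists>C. openin T C \<and> closedin T C \<and> x \<in> C \<and> C \<subseteq> V"
proof -
  have x: "x \<in> topspace T" using assms openin_subset by blast
  define \<C> where "\<C> = {t. closedin T t \<and> openin T t \<and> x \<in> t}"
  have conn: "quasi_component_of T x = connected_component_of T x"
    by (rule quasi_eq_connected_component_of) (use compact Hausdorff in blast)
  obtain a where "connected_component_of_set T x \<subseteq> {a}"
    using totally_disconnected[OF connectedin_connected_component_of] by blast
  moreover have "x \<in> connected_component_of_set T x"
    using x by (simp add: connected_component_of_refl)
  ultimately have "connected_component_of_set T x = {x}" by auto
  then have "quasi_component_of_set T x = {x}" using conn by simp
  then have Int: "\<Inter>\<C> = {x}" using quasi_component_of_set[of T x] x by (simp add: \<C>_def)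
  have "compactin T (topspace T - V)"
    using assms(1) compact by (intro closedin_compact_space) auto
  moreover have "\<forall>U\<in>(\<lambda>t. topspace T - t) ` \<C>. openin T U" by (auto simp: \<C>_def)
  moreover have "topspace T - V \<subseteq> \<Union>((\<lambda>t. topspace T - t) ` \<C>)" using Int assms(2) by auto
  ultimately obtain \<F> where \<F>: "finite \<F>" "\<F> \<subseteq> (\<lambda>t. topspace T - t) ` \<C>" "topspace T - V \<subseteq> \<Union>\<F>"
    unfolding compactin_def by metis
  obtain \<D> where \<D>: "finite \<D>" "\<D> \<subseteq> \<C>" "\<F> = (\<lambda>t. topspace T - t) ` \<D>"
    using finite_subset_image[OF \<F>(1,2)] by blast
  have "topspace T \<in> \<C>" using x by (simp add: \<C>_def)
  \<comment> \<open>Inserting the whole space keeps the intersection inside it when the finite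
    family is empty.\<close>
  define C where "C = \<Inter>(insert (topspace T) \<D>)"
  have sub: "insert (topspace T) \<D> \<subseteq> \<C>" using \<D>(2) \<open>topspace T \<in> \<C>\<close> by simp
  have "openin T C" unfolding C_def
    by (rule openin_Inter) (use \<D>(1) sub in \<open>auto simp: \<C>_def\<close>)
  moreover have "closedin T C" unfolding C_def
    by (rule closedin_Inter) (use sub in \<open>auto simp: \<C>_def\<close>)
  moreover have "x \<in> C" using sub by (auto simp: C_def \<C>_def)
  moreover have "C \<subseteq> V" using \<F>(3) unfolding \<D>(3) C_def by auto
  ultimately show ?thesis by blast
qed

text \<open>The normal subgroup is the class of the identity under the syntactic congruence of a clopen
  set \<open>C\<close>; it is open because projection along a compact factor is a closed map.\<close>

lemma open_normal_subgroup_neighbourhood: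
  assumes V: "openin T V" "\<one> \<in> V"
  shows "\<exists>K. K \<lhd> G \<and> openin T K \<and> K \<subseteq> V"
proof -
  obtain C where C: "openin T C" "closedin T C" "\<one> \<in> C" "C \<subseteq> V"
    using clopen_neighbourhood[OF V] by blast
  define K where "K = {g \<in> carrier G. \<forall>x\<in>carrier G. \<forall>y\<in>carrier G. x \<otimes> g \<otimes> y \<in> C \<longleftrightarrow> x \<otimes> y \<in> C}"
  have K1: "x \<otimes> g \<otimes> y \<in> C \<longleftrightarrow> x \<otimes> y \<in> C"
    if "g \<in> K" "x \<in> carrier G" "y \<in> carrier G" for g x y
    using that by (simp add: K_def)
  have sub: "subgroup K G"
  proof (rule subgroupI)
    show "K \<subseteq> carrier G" "K \<noteq> {}" by (auto simp: K_def intro!: exI[of _ \<one>])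
    fix g assume g: "g \<in> K"
    then have gc: "g \<in> carrier G" by (simp add: K_def)
    have "x \<otimes> inv g \<otimes> y \<in> C \<longleftrightarrow> x \<otimes> y \<in> C" if "x \<in> carrier G" "y \<in> carrier G" for x y
      using K1[OF g, of "x \<otimes> inv g" y] that gc by (simp add: m_assoc)
    then show "inv g \<in> K" using gc by (simp add: K_def)
    fix h assume h: "h \<in> K"
    then have hc: "h \<in> carrier G" by (simp add: K_def)
    have "x \<otimes> (g \<otimes> h) \<otimes> y \<in> C \<longleftrightarrow> x \<otimes> y \<in> C" if "x \<in> carrier G" "y \<in> carrier G" for x y
      using K1[OF g, of x "h \<otimes> y"] K1[OF h, of x y] that gc hc by (simp add: m_assoc)
    then show "g \<otimes> h \<in> K" using gc hc by (simp add: K_def)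
  qed
  have "K \<lhd> G"
  proof (rule normal_invI[OF sub])
    fix z g assume z: "z \<in> carrier G" and g: "g \<in> K"
    then have gc: "g \<in> carrier G" by (simp add: K_def)
    have "x \<otimes> (z \<otimes> g \<otimes> inv z) \<otimes> y \<in> C \<longleftrightarrow> x \<otimes> y \<in> C" if "x \<in> carrier G" "y \<in> carrier G" for x y
    proof -
      have "x \<otimes> z \<otimes> (inv z \<otimes> y) = x \<otimes> (z \<otimes> inv z) \<otimes> y"
        using that z by (simp only: m_assoc inv_closed m_closed)
      then have "x \<otimes> z \<otimes> (inv z \<otimes> y) = x \<otimes> y" using that z by simp
      then show ?thesis using K1[OF g, of "x \<otimes> z" "inv z \<otimes> y"] that z gc by (simp add: m_assoc)
    qed
    then show "z \<otimes> g \<otimes> inv z \<in> K" using z gc by (simp add: K_def)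
  qed
  moreover have "K \<subseteq> C"
  proof
    fix g assume "g \<in> K"
    then show "g \<in> C" using K1[of g \<one> \<one>] C(3) by (simp add: K_def)
  qed
  moreover have "openin T K"
  proof -
    let ?T2 = "prod_topology T T" and ?T3 = "prod_topology T (prod_topology T T)"
    let ?f = "\<lambda>p. fst (snd p) \<otimes> fst p \<otimes> snd (snd p)" and ?h = "\<lambda>p. fst (snd p) \<otimes> snd (snd p)"
    have c: "continuous_map ?T3 T fst" "continuous_map ?T3 T (\<lambda>p. fst (snd p))"
      "continuous_map ?T3 T (\<lambda>p. snd (snd p))"
      using continuous_map_fst continuous_map_compose[OF continuous_map_snd continuous_map_fst]
        continuous_map_compose[OF continuous_map_snd continuous_map_snd] by (auto simp: comp_def)
    have f: "continuous_map ?T3 T ?f" and h: "continuous_map ?T3 T ?h"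
      using c by (auto intro!: continuous_map_mult)
    have C': "closedin T (topspace T - C)" using C(1) by auto
    \<comment> \<open>The triples (g, x, y) for which x g y and x y lie on different sides of
      \<open>C\<close>. Closedness of this set uses both that \<open>C\<close> is closed and that it
      is open.\<close>
    define S where "S = {p \<in> topspace ?T3. ?f p \<in> C} \<inter> {p \<in> topspace ?T3. ?h p \<in> topspace T - C} \<union>
      {p \<in> topspace ?T3. ?f p \<in> topspace T - C} \<inter> {p \<in> topspace ?T3. ?h p \<in> C}"
    have "closedin ?T3 S" unfolding S_def
      by (intro closedin_Un closedin_Int closedin_continuous_map_preimage[OF f]
          closedin_continuous_map_preimage[OF h] C(2) C')
    moreover have "closed_map ?T3 T fst"
      by (rule closed_map_fst) (simp add: compact_space_prod_topology compact)
    ultimately have "closedin T (fst ` S)" unfolding closed_map_def by blast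
    then have "openin T (topspace T - fst ` S)" by blast
    also have "topspace T - fst ` S = K"
    proof (intro equalityI subsetI)
      fix g assume g: "g \<in> topspace T - fst ` S"
      have "x \<otimes> g \<otimes> y \<in> C \<longleftrightarrow> x \<otimes> y \<in> C" if "x \<in> carrier G" "y \<in> carrier G" for x y
      proof (rule ccontr)
        assume "\<not> ?thesis"
        then have "(g, x, y) \<in> S" using g that by (auto simp: S_def topspace_eq)
        then have "g \<in> fst ` S" by (rule image_eqI[rotated]) simp
        then show False using g by simp
      qed
      then show "g \<in> K" using g by (simp add: K_def topspace_eq)
    next
      fix g assume "g \<in> K"
      then have "g \<in> topspace T" by (simp add: K_def topspace_eq)
      moreover have "(g, x, y) \<notin> S" for x y
        using K1[OF \<open>g \<in> K\<close>, of x y] by (auto simp: S_def topspace_eq)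
      ultimately show "g \<in> topspace T - fst ` S" by force
    qed
    finally show ?thesis .
  qed
  ultimately show ?thesis using C(4) by blast
qed

text \<open>The cosets form a disjoint open cover, which has no proper subcover.\<close>

lemma finite_rcosets_open:
  assumes K: "subgroup K G" "openin T K"
  shows "finite (rcosets K)"
proof -
  have "compactin T (carrier G)" using compact by (simp add: compact_space_def topspace_eq)
  moreover have "\<forall>U\<in>rcosets K. openin T U"
    using openin_r_coset[OF K] by (auto simp: RCOSETS_def)
  moreover have "carrier G \<subseteq> \<Union>(rcosets K)" using rcosets_part_G[OF K(1)] by simp
  ultimately obtain \<F> where \<F>: "finite \<F>" "\<F> \<subseteq> rcosets K" "carrier G \<subseteq> \<Union>\<F>"
    unfolding compactin_def by metis
  have "rcosets K \<subseteq> \<F>"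
  proof
    fix R assume R: "R \<in> rcosets K"
    then obtain g where g: "g \<in> carrier G" "R = K #> g" by (auto simp: RCOSETS_def)
    then have "g \<in> R" using rcos_self[OF g(1) K(1)] by simp
    obtain F where F: "F \<in> \<F>" "g \<in> F" using \<F>(3) g(1) by blast
    then have "R = F" using rcos_disjoint[OF K(1)] R \<F>(2) \<open>g \<in> R\<close> by (auto simp: pairwise_def disjnt_def)
    then show "R \<in> \<F>" using F by simp
  qed
  then show ?thesis using \<F>(1) finite_subset by blast
qed

end

text \<open>Choose \<open>p ^ k\<close> elements of the infinite pro-p subgroup \<open>H\<close> and
  make \<open>K\<close> so small that it separates them. The image of \<open>H\<close> in the
  quotient then has at least \<open>p ^ k\<close> elements, and its order is a power of
  \<open>p\<close>, hence a multiple of \<open>p ^ k\<close>. Lagrange transfers this to the order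
  of G/K.\<close>

lemma (in profinite_group) open_normal_subgroup_large_index:
  assumes inf: "infinite (carrier G)" and vp: "virtually_pro_p p G T" and p: "p > 1"
    and V: "openin T V" "\<one> \<in> V"
  shows "\<exists>K. K \<lhd> G \<and> openin T K \<and> K \<subseteq> V \<and> p ^ k dvd order (G Mod K)"
proof -
  obtain H where H: "subgroup H G" "openin T H"
    and pro: "pro_p_group p (G\<lparr>carrier := H\<rparr>) (subtopology T H)"
    using vp unfolding virtually_pro_p_def by blast
  have "infinite H"
  proof
    assume "finite H"
    then have "finite R" if "R \<in> rcosets H" for R
      using that by (auto simp: RCOSETS_def r_coset_def)
    then have "finite (\<Union>(rcosets H))" using finite_rcosets_open[OF H] by blast
    then show False using rcosets_part_G[OF H(1)] inf by simp
  qed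
  then obtain F where F: "finite F" "card F = p ^ k" "F \<subseteq> H"
    using infinite_arbitrarily_large by blast
  have FG: "F \<subseteq> carrier G" using F(3) subgroup.subset[OF H(1)] by blast
  define D where "D = (\<lambda>(x, y). x \<otimes> inv y) ` {(x, y). x \<in> F \<and> y \<in> F \<and> x \<noteq> y}"
  have "finite {(x, y). x \<in> F \<and> y \<in> F \<and> x \<noteq> y}"
    by (rule finite_subset[of _ "F \<times> F"]) (use F(1) in auto)
  then have "finite D" by (simp add: D_def)
  moreover have "D \<subseteq> topspace T" using FG by (auto simp: D_def topspace_eq)
  ultimately have "closedin T D" using Hausdorff closedin_Hausdorff_finite by blast
  have "\<one> \<notin> D"
  proof
    assume "\<one> \<in> D"
    then obtain x y where "x \<in> F" "y \<in> F" "x \<noteq> y" "\<one> = x \<otimes> inv y" by (auto simp: D_def)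
    then show False using FG by (metis inv_solve_right l_one one_closed subsetD)
  qed
  \<comment> \<open>Removing the quotients x y^(-1) of distinct chosen elements makes their cosets
    distinct. Intersecting with \<open>H\<close> places \<open>K\<close> inside \<open>H\<close>,
    where the pro-p condition can be applied to it.\<close>
  have "openin T (V \<inter> H - D)" using V(1) H(2) \<open>closedin T D\<close> by (intro openin_diff openin_Int)
  moreover have "\<one> \<in> V \<inter> H - D" using V(2) subgroup.one_closed[OF H(1)] \<open>\<one> \<notin> D\<close> by simp
  ultimately obtain K where K: "K \<lhd> G" "openin T K" "K \<subseteq> V \<inter> H - D"
    using open_normal_subgroup_neighbourhood by blast
  interpret K: normal K G by fact
  let ?R = "(\<lambda>x. K #> x) ` H"
  have "K \<lhd> G\<lparr>carrier := H\<rparr>"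
    using normal_restrict_supergroup[OF H(1) K(1)] K(3) by blast
  moreover have "openin (subtopology T H) K"
    using K(2,3) openin_open_subtopology[OF H(2)] by blast
  ultimately obtain j where "order (G\<lparr>carrier := H\<rparr> Mod K) = p ^ j"
    using pro unfolding pro_p_group_def by blast
  moreover have "carrier (G\<lparr>carrier := H\<rparr> Mod K) = ?R"
    by (auto simp: FactGroup_def RCOSETS_def r_coset_def)
  ultimately have R: "card ?R = p ^ j" by (simp add: order_def)
  have "inj_on (\<lambda>x. K #> x) F"
  proof (rule inj_onI, rule ccontr)
    fix x y assume xy: "x \<in> F" "y \<in> F" "K #> x = K #> y" "x \<noteq> y"
    have "x \<in> K #> y" using rcos_self[OF _ K.subgroup_axioms, of x] xy FG by auto
    then obtain h where "h \<in> K" "x = h \<otimes> y" by (auto simp: r_coset_def)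
    then have "x \<otimes> inv y \<in> K" using xy FG K.subset by (auto simp: m_assoc)
    then show False using xy K(3) by (auto simp: D_def)
  qed
  then have "p ^ k = card ((\<lambda>x. K #> x) ` F)" using F(2) by (simp add: card_image)
  also have "\<dots> \<le> card ?R"
  proof (rule card_mono)
    \<comment> \<open>A positive cardinality excludes an infinite image, whose \<open>card\<close>
      would be 0.\<close>
    show "finite ?R" using R p by (intro card_ge_0_finite) simp
  qed (use F(3) in blast)
  finally have "k \<le> j" using p unfolding R by (simp add: power_increasing_iff)
  have hom: "group_hom G (G Mod K) (\<lambda>x. K #> x)"
    by (intro group_hom.intro group_hom_axioms.intro K.factorgroup_is_group K.r_coset_hom_Mod group_axioms)
  have "subgroup ?R (G Mod K)" by (rule group_hom.subgroup_img_is_subgroup[OF hom H(1)])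
  from group.lagrange[OF K.factorgroup_is_group this]
  have "card ?R dvd order (G Mod K)" by (metis dvd_triv_right)
  with le_imp_power_dvd[OF \<open>k \<le> j\<close>] have "p ^ k dvd order (G Mod K)"
    unfolding R by (rule dvd_trans)
  then show ?thesis using K by blast
qed


subsection \<open>Characters of a profinite group and of its finite quotients\<close>

text \<open>Writing \<open>\<rho> g = 1 + b\<close> one has \<open>2b = (\<rho> (g\<^sup>2) - 1) - b\<^sup>2\<close>. If the entries of all such \<open>b\<close> are at
  most \<open>d \<le> 1/(2n)\<close>, they are therefore at most \<open>(d + n d\<^sup>2)/2 \<le> 3d/4\<close>, and this can be iterated.\<close>

lemma (in topological_group) rep_trivial_on_small_subgroups:
  assumes "continuous_rep G T n \<rho>"
  shows "\<exists>U. openin T U \<and> \<one> \<in> U \<and> (\<forall>K. subgroup K G \<longrightarrow> K \<subseteq> U \<longrightarrow> (\<forall>k\<in>K. \<rho> k = 1\<^sub>m n))"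
proof -
  have rep: "mat_rep G n \<rho>" and cont: "\<And>i j. i < n \<Longrightarrow> j < n \<Longrightarrow> continuous_map T euclidean (\<lambda>g. \<rho> g $$ (i, j))"
    using assms by (auto simp: continuous_rep_def mat_rep_def)
  note r = mat_repD[OF group_axioms rep]
  define b where "b g i j = \<rho> g $$ (i, j) - (if i = j then 1 else 0)" for g i j
  \<comment> \<open>For n = 0 the division convention gives e = 0; this is harmless, as there are
    then no entries to bound.\<close>
  define e where "e = 1 / (2 * real n)"
  define U where "U = topspace T \<inter> \<Inter>((\<lambda>(i, j). {g \<in> topspace T. \<rho> g $$ (i, j) \<in> ball (if i = j then 1 else 0) e}) ` ({..<n} \<times> {..<n}))"
  have "openin T {g \<in> topspace T. \<rho> g $$ (i, j) \<in> ball c e}" if "i < n" "j < n" for i j c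
    by (rule openin_continuous_map_preimage[OF cont[OF that]]) simp
  then have "openin T U" unfolding U_def
    by (intro openin_Int_Inter) (auto simp del: mem_ball)
  moreover have "\<one> \<in> U"
    by (auto simp: U_def topspace_eq r(3) e_def)
  moreover have "\<rho> k = 1\<^sub>m n" if K: "subgroup K G" "K \<subseteq> U" and k: "k \<in> K" for K k
  proof -
    have KG: "K \<subseteq> carrier G" using K(1) by (rule subgroup.subset)
    have small: "norm (b g i j) \<le> e * (3 / 4) ^ m" if "g \<in> K" "i < n" "j < n" for g i j m
      using that
    proof (induction m arbitrary: g i j)
      case 0
      then have "\<rho> g $$ (i, j) \<in> ball (if i = j then 1 else 0) e"
        using K(2) unfolding U_def by blast
      then show ?case by (simp add: b_def dist_norm norm_minus_commute)
    next
      case (Suc m)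
      let ?d = "e * (3 / 4) ^ m"
      have g: "g \<in> carrier G" and gg: "g \<otimes> g \<in> K"
        using Suc.prems(1) KG subgroup.m_closed[OF K(1)] by auto
      have n: "real n > 0" using Suc.prems by simp
      have entry: "\<rho> g $$ (i, j) = (if i = j then 1 else 0) + b g i j" for i j by (simp add: b_def)
      have "\<rho> (g \<otimes> g) $$ (i, j) = (\<Sum>l<n. \<rho> g $$ (i, l) * \<rho> g $$ (l, j))"
        using r(1,2) g Suc.prems by (simp add: index_mult_carrier[of _ n n _ n])
      also have "\<dots> = (\<Sum>l<n. (if i = l then (if l = j then 1 else 0) else 0) + (if i = l then b g l j else 0)
          + (if l = j then b g i l else 0) + b g i l * b g l j)"
        by (intro sum.cong refl) (auto simp: entry algebra_simps)
      also have "\<dots> = (if i = j then 1 else 0) + 2 * b g i j + (\<Sum>l<n. b g i l * b g l j)"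
        using Suc.prems by (simp add: sum.distrib)
      finally have "2 * b g i j = b (g \<otimes> g) i j - (\<Sum>l<n. b g i l * b g l j)"
        by (simp add: b_def[of "g \<otimes> g"])
      then have "2 * norm (b g i j) = norm (b (g \<otimes> g) i j - (\<Sum>l<n. b g i l * b g l j))"
        by (metis norm_mult norm_numeral)
      also have "\<dots> \<le> norm (b (g \<otimes> g) i j) + (\<Sum>l<n. norm (b g i l) * norm (b g l j))"
        by (rule order_trans[OF norm_triangle_ineq4]) (simp add: sum_norm_le norm_mult)
      also have "\<dots> \<le> ?d + (\<Sum>l<n. ?d * ?d)"
      proof (rule add_mono)
        show "norm (b (g \<otimes> g) i j) \<le> ?d" by (rule Suc.IH[OF gg Suc.prems(2,3)])
        show "(\<Sum>l<n. norm (b g i l) * norm (b g l j)) \<le> (\<Sum>l<n. ?d * ?d)"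
          using Suc.prems by (intro sum_mono mult_mono Suc.IH) (auto simp: e_def)
      qed
      also have "(\<Sum>l<n. ?d * ?d) = (real n * e) * (3 / 4) ^ m * ?d" by simp
      also have "\<dots> \<le> 1 / 2 * ?d"
      proof (rule mult_right_mono)
        have "(3 / 4 :: real) ^ m \<le> 1" by (simp add: power_le_one)
        then show "(real n * e) * (3 / 4) ^ m \<le> 1 / 2" using n by (simp add: e_def)
      qed (simp add: e_def)
      finally show ?case by simp
    qed
    have "b k i j = 0" if "i < n" "j < n" for i j
    proof -
      have "(\<lambda>m. e * (3 / 4) ^ m) \<longlonglongrightarrow> e * 0"
        by (intro tendsto_mult_left LIMSEQ_power_zero) simp
      then have "norm (b k i j) \<le> e * 0"
        by (rule LIMSEQ_le_const) (use small[OF k that] in blast)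
      then show ?thesis by simp
    qed
    then show ?thesis
      using r(1)[of k] k KG by (intro eq_matI) (auto simp: b_def)
  qed
  ultimately show ?thesis by blast
qed

text \<open>Triviality on \<open>K\<close> is asked of an underlying representation, so that it need
  not be recovered from character values.\<close>

definition Irr_trivial_on :: "('a, 'b) monoid_scheme \<Rightarrow> 'a topology \<Rightarrow> 'a set \<Rightarrow> ('a \<Rightarrow> complex) set" where
  "Irr_trivial_on G T K = {\<phi>. \<exists>n \<rho>. continuous_rep G T n \<rho> \<and> irreducible_rep G n \<rho> \<and>
     (\<forall>k\<in>K. \<rho> k = 1\<^sub>m n) \<and> \<phi> = (\<lambda>g\<in>carrier G. mat_trace (\<rho> g))}"

text \<open>One neighbourhood serves all subgroups inside it, so for finitely many characters the
  neighbourhoods can be intersected before \<open>K\<close> is chosen.\<close>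

lemma (in topological_group) Irr_trivial_on_small_subgroups:
  assumes "\<phi> \<in> Irr G T"
  shows "\<exists>U. openin T U \<and> \<one> \<in> U \<and> (\<forall>K. subgroup K G \<longrightarrow> K \<subseteq> U \<longrightarrow> \<phi> \<in> Irr_trivial_on G T K)"
proof -
  obtain n \<rho> where \<rho>: "continuous_rep G T n \<rho>" "irreducible_rep G n \<rho>"
    and \<phi>: "\<phi> = (\<lambda>g\<in>carrier G. mat_trace (\<rho> g))"
    using assms unfolding Irr_def by blast
  obtain U where U: "openin T U" "\<one> \<in> U"
    and triv: "\<And>K. subgroup K G \<Longrightarrow> K \<subseteq> U \<Longrightarrow> \<forall>k\<in>K. \<rho> k = 1\<^sub>m n"
    using rep_trivial_on_small_subgroups[OF \<rho>(1)] by blast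
  have "\<phi> \<in> Irr_trivial_on G T K" if "subgroup K G" "K \<subseteq> U" for K
    using \<rho> \<phi> triv[OF that] unfolding Irr_trivial_on_def by blast
  then show ?thesis using U by blast
qed

lemma (in topological_group) continuous_map_cosets:
  assumes K: "subgroup K G" "openin T K"
  shows "continuous_map T euclidean (\<lambda>g. f (K #> g))"
proof -
  have "openin T {g \<in> carrier G. f (K #> g) \<in> U}" for U
  proof -
    let ?S = "{g \<in> carrier G. f (K #> g) \<in> U}"
    have "?S = (\<Union>g\<in>?S. K #> g)"
    proof (intro equalityI subsetI)
      fix g assume "g \<in> ?S"
      then show "g \<in> (\<Union>g\<in>?S. K #> g)" using rcos_self[OF _ K(1), of g] by blast
    next
      fix h assume "h \<in> (\<Union>g\<in>?S. K #> g)"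
      then obtain g where g: "g \<in> ?S" "h \<in> K #> g" by blast
      then have "K #> g = K #> h" using repr_independence[OF g(2) _ K(1)] by simp
      moreover have "h \<in> carrier G"
        using g r_coset_subset_G[OF subgroup.subset[OF K(1)], of g] by blast
      ultimately show "h \<in> ?S" using g(1) by simp
    qed
    also have "openin T \<dots>" by (rule openin_Union) (auto intro: openin_r_coset[OF K])
    finally show ?thesis .
  qed
  then show ?thesis by (simp add: continuous_map_def topspace_eq)
qed

text \<open>Irreducibility depends only on the set of matrices, which is the same for a
  representation of a quotient and for its inflation.\<close>

lemma irreducible_rep_cong:
  assumes "\<rho> ` carrier G = \<sigma> ` carrier H"
  shows "irreducible_rep G n \<rho> \<longleftrightarrow> irreducible_rep H n \<sigma>"
proof -
  have "(\<forall>g\<in>carrier G. \<forall>w\<in>W. \<rho> g *\<^sub>v w \<in> W) \<longleftrightarrow>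
      (\<forall>g\<in>carrier H. \<forall>w\<in>W. \<sigma> g *\<^sub>v w \<in> W)" for W
  proof -
    have "(\<forall>g\<in>carrier G. \<forall>w\<in>W. \<rho> g *\<^sub>v w \<in> W) \<longleftrightarrow>
        (\<forall>A\<in>\<rho> ` carrier G. \<forall>w\<in>W. A *\<^sub>v w \<in> W)" by simp
    also have "\<dots> \<longleftrightarrow> (\<forall>g\<in>carrier H. \<forall>w\<in>W. \<sigma> g *\<^sub>v w \<in> W)"
      unfolding assms by simp
    finally show ?thesis .
  qed
  then show ?thesis by (simp only: irreducible_rep_def)
qed

lemma (in topological_group) Irr_trivial_on_eq_inflations:
  assumes K: "K \<lhd> G" "openin T K"
  shows "Irr_trivial_on G T K = (\<lambda>\<phi>. \<lambda>g\<in>carrier G. \<phi> (K #> g)) ` irr_chars (G Mod K)"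
proof (intro equalityI subsetI)
  interpret K: normal K G by fact
  have sK: "subgroup K G" by (rule K.subgroup_axioms)
  have Q: "group (G Mod K)" by (rule K.factorgroup_is_group)
  have car: "carrier (G Mod K) = (\<lambda>g. K #> g) ` carrier G"
    by (auto simp: FactGroup_def RCOSETS_def)
  {
    fix \<phi> assume "\<phi> \<in> Irr_trivial_on G T K"
    then obtain n \<rho> where \<rho>: "continuous_rep G T n \<rho>" "irreducible_rep G n \<rho>"
      and triv: "\<And>k. k \<in> K \<Longrightarrow> \<rho> k = 1\<^sub>m n" and \<phi>: "\<phi> = (\<lambda>g\<in>carrier G. mat_trace (\<rho> g))"
      unfolding Irr_trivial_on_def by blast
    have rep: "mat_rep G n \<rho>" using \<rho>(1) by (simp add: continuous_rep_def mat_rep_def)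
    note r = mat_repD[OF group_axioms rep]
    \<comment> \<open>The choice of a representative is immaterial: two of them differ by a factor
      from \<open>K\<close>, on which \<open>\<rho>\<close> is trivial.\<close>
    define \<sigma> where "\<sigma> R = \<rho> (SOME h. h \<in> R)" for R
    have \<sigma>: "\<sigma> (K #> g) = \<rho> g" if g: "g \<in> carrier G" for g
    proof -
      have "(SOME h. h \<in> K #> g) \<in> K #> g" using rcos_self[OF g sK] by (rule someI)
      then obtain k where "k \<in> K" "(SOME h. h \<in> K #> g) = k \<otimes> g" by (auto simp: r_coset_def)
      then show ?thesis using r(1)[OF g] r(2)[of k g] g K.subset by (simp add: \<sigma>_def triv subset_iff)
    qed
    have "mat_rep (G Mod K) n \<sigma>"
    proof (rule mat_repI[OF Q])
      show "\<sigma> R \<in> carrier_mat n n" if "R \<in> carrier (G Mod K)" for R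
        using that by (auto simp: car \<sigma> r(1))
      show "\<sigma> (R \<otimes>\<^bsub>G Mod K\<^esub> S) = \<sigma> R * \<sigma> S"
        if "R \<in> carrier (G Mod K)" "S \<in> carrier (G Mod K)" for R S
        using that by (auto simp: car \<sigma> r(2) K.rcos_sum)
      show "\<sigma> \<one>\<^bsub>G Mod K\<^esub> = 1\<^sub>m n"
        using \<sigma>[of \<one>] coset_mult_one[OF K.subset] by (simp add: r(3))
    qed
    moreover have "irreducible_rep (G Mod K) n \<sigma>"
      using \<rho>(2) by (subst irreducible_rep_cong[of _ _ \<rho> G]) (auto simp: car image_image \<sigma>)
    ultimately have "(\<lambda>R\<in>carrier (G Mod K). mat_trace (\<sigma> R)) \<in> irr_chars (G Mod K)"
      unfolding irr_chars_def by blast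
    moreover have "\<phi> = (\<lambda>g\<in>carrier G. (\<lambda>R\<in>carrier (G Mod K). mat_trace (\<sigma> R)) (K #> g))"
      unfolding \<phi> by (rule restrict_ext) (simp add: car \<sigma>)
    ultimately show "\<phi> \<in> (\<lambda>\<phi>. \<lambda>g\<in>carrier G. \<phi> (K #> g)) ` irr_chars (G Mod K)" by blast
  }
  {
    fix \<phi> assume "\<phi> \<in> (\<lambda>\<phi>. \<lambda>g\<in>carrier G. \<phi> (K #> g)) ` irr_chars (G Mod K)"
    then obtain n \<sigma> where \<sigma>: "mat_rep (G Mod K) n \<sigma>" "irreducible_rep (G Mod K) n \<sigma>"
      and \<phi>: "\<phi> = (\<lambda>g\<in>carrier G. (\<lambda>R\<in>carrier (G Mod K). mat_trace (\<sigma> R)) (K #> g))"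
      unfolding irr_chars_def by blast
    note s = mat_repD[OF Q \<sigma>(1)]
    define \<rho> where "\<rho> g = \<sigma> (K #> g)" for g
    have "mat_rep G n \<rho>"
    proof (rule mat_repI[OF group_axioms])
      show "\<rho> (g \<otimes> h) = \<rho> g * \<rho> h" if "g \<in> carrier G" "h \<in> carrier G" for g h
        using s(2)[of "K #> g" "K #> h"] that by (simp add: \<rho>_def car K.rcos_sum)
      show "\<rho> \<one> = 1\<^sub>m n" using s(3) coset_mult_one[OF K.subset] by (simp add: \<rho>_def)
    qed (use s(1) in \<open>auto simp: \<rho>_def car\<close>)
    moreover have "continuous_map T euclidean (\<lambda>g. \<rho> g $$ (i, j))" for i j
      unfolding \<rho>_def by (rule continuous_map_cosets[OF sK K(2)])
    ultimately have "continuous_rep G T n \<rho>" by (simp add: continuous_rep_def mat_rep_def)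
    moreover have "irreducible_rep G n \<rho>"
      using \<sigma>(2) by (subst irreducible_rep_cong[of _ _ \<sigma> "G Mod K"]) (auto simp: car image_image \<rho>_def)
    moreover have "\<rho> k = 1\<^sub>m n" if "k \<in> K" for k
      using that s(3) K.rcos_const[OF group_axioms that] by (simp add: \<rho>_def)
    moreover have "\<phi> = (\<lambda>g\<in>carrier G. mat_trace (\<rho> g))"
      unfolding \<phi> by (rule restrict_ext) (simp add: car \<rho>_def)
    ultimately show "\<phi> \<in> Irr_trivial_on G T K" unfolding Irr_trivial_on_def by blast
  }
qed

lemma (in profinite_group) Irr_trivial_on_sum_squares:
  assumes K: "K \<lhd> G" "openin T K"
  shows "finite (Irr_trivial_on G T K)"
    and "(\<Sum>\<phi>\<in>Irr_trivial_on G T K. \<phi> \<one> ^ 2) = of_nat (order (G Mod K))"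
proof -
  interpret K: normal K G by fact
  have Q: "group (G Mod K)" by (rule K.factorgroup_is_group)
  have fin: "finite (carrier (G Mod K))"
    using finite_rcosets_open[OF K.subgroup_axioms K(2)] by (simp add: FactGroup_def)
  have car: "carrier (G Mod K) = (\<lambda>g. K #> g) ` carrier G"
    by (auto simp: FactGroup_def RCOSETS_def)
  have inj: "inj_on (\<lambda>\<phi>. \<lambda>g\<in>carrier G. \<phi> (K #> g)) (irr_chars (G Mod K))"
  proof (rule inj_onI)
    fix \<phi> \<psi> assume \<phi>: "\<phi> \<in> irr_chars (G Mod K)" and \<psi>: "\<psi> \<in> irr_chars (G Mod K)"
      and eq: "(\<lambda>g\<in>carrier G. \<phi> (K #> g)) = (\<lambda>g\<in>carrier G. \<psi> (K #> g))"
    have ext: "\<xi> \<in> extensional (carrier (G Mod K))" if "\<xi> \<in> irr_chars (G Mod K)" for \<xi>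
      using that unfolding irr_chars_def by auto
    show "\<phi> = \<psi>"
    proof (rule extensionalityI[OF ext[OF \<phi>] ext[OF \<psi>]])
      fix R assume "R \<in> carrier (G Mod K)"
      then obtain g where "g \<in> carrier G" "R = K #> g" unfolding car by blast
      then show "\<phi> R = \<psi> R" using fun_cong[OF eq, of g] by simp
    qed
  qed
  show "finite (Irr_trivial_on G T K)"
    unfolding Irr_trivial_on_eq_inflations[OF K] using irr_chars_sum_squares(1)[OF Q fin] by simp
  have "(\<Sum>\<phi>\<in>Irr_trivial_on G T K. \<phi> \<one> ^ 2) = (\<Sum>\<phi>\<in>irr_chars (G Mod K). \<phi> \<one>\<^bsub>G Mod K\<^esub> ^ 2)"
    unfolding Irr_trivial_on_eq_inflations[OF K] sum.reindex[OF inj]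
    using coset_mult_one[OF K.subset] by simp
  then show "(\<Sum>\<phi>\<in>Irr_trivial_on G T K. \<phi> \<one> ^ 2) = of_nat (order (G Mod K))"
    using irr_chars_sum_squares(2)[OF Q fin] by simp
qed

text \<open>The finitely many characters of degree not divisible by \<open>p ^ N\<close> are all
  trivial on one \<open>K\<close> with \<open>p ^ N\<close> dividing |G/K|. This order is the sum of
  the squared degrees of all characters trivial on \<open>K\<close>, and those outside the chosen
  set contribute multiples of \<open>p ^ N\<close>.\<close>

lemma (in profinite_group) degree_square_sum_dvd:
  assumes inf: "infinite (carrier G)" and vp: "virtually_pro_p p G T" and p: "p > 1"
    and fin: "\<And>n. finite {\<phi> \<in> Irr G T. \<phi> \<one> = of_nat n}"
    and fin_off: "finite {n. \<not> p ^ N dvd n \<and> rep_count G T n \<noteq> 0}"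
  shows "int p ^ N dvd (\<Sum>n | \<not> p ^ N dvd n \<and> rep_count G T n \<noteq> 0. int (rep_count G T n) * int n ^ 2)"
proof -
  have "\<forall>\<phi>\<in>Irr G T. \<exists>n. \<phi> \<one> = of_nat n" using Irr_degree[OF group_axioms] by blast
  then obtain d where d: "\<And>\<phi>. \<phi> \<in> Irr G T \<Longrightarrow> \<phi> \<one> = of_nat (d \<phi>)" by metis
  have fiber: "{\<phi> \<in> Irr G T. \<phi> \<one> = of_nat n} = {\<phi> \<in> Irr G T. d \<phi> = n}" for n
    by (intro Collect_cong conj_cong refl) (simp add: d)
  define E where "E = {\<phi> \<in> Irr G T. \<not> p ^ N dvd d \<phi>}"
  let ?S = "{n. \<not> p ^ N dvd n \<and> rep_count G T n \<noteq> 0}"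
  have count: "rep_count G T n = card {\<phi> \<in> E. d \<phi> = n}" if "\<not> p ^ N dvd n" for n
    unfolding rep_count_def fiber by (rule arg_cong[of _ _ card]) (use that in \<open>auto simp: E_def\<close>)
  have finE: "finite {\<phi> \<in> E. d \<phi> = n}" for n
    by (rule finite_subset[OF _ fin[of n]]) (auto simp: E_def d)
  have dE: "d ` E = ?S"
  proof (intro equalityI subsetI)
    fix n assume "n \<in> d ` E"
    then obtain \<phi> where \<phi>: "\<phi> \<in> E" "n = d \<phi>" by blast
    then have n: "\<not> p ^ N dvd n" by (simp add: E_def)
    moreover have "card {\<phi> \<in> E. d \<phi> = n} \<noteq> 0" using finE[of n] \<phi> by (auto simp: card_eq_0_iff)
    ultimately show "n \<in> ?S" using count by simp
  next
    fix n assume "n \<in> ?S"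
    then have "card {\<phi> \<in> E. d \<phi> = n} \<noteq> 0" using count by auto
    then show "n \<in> d ` E" by (metis (mono_tags, lifting) card.empty empty_Collect_eq imageI)
  qed
  have "E = (\<Union>n\<in>?S. {\<phi> \<in> E. d \<phi> = n})" using dE by blast
  then have "finite E" using fin_off finE by (metis (no_types, lifting) finite_UN_I)
  have "\<forall>\<phi>\<in>E. \<exists>U. openin T U \<and> \<one> \<in> U \<and> (\<forall>K. subgroup K G \<longrightarrow> K \<subseteq> U \<longrightarrow> \<phi> \<in> Irr_trivial_on G T K)"
    using Irr_trivial_on_small_subgroups by (simp add: E_def)
  from bchoice[OF this] obtain U where U: "\<And>\<phi>. \<phi> \<in> E \<Longrightarrow> openin T (U \<phi>) \<and> \<one> \<in> U \<phi>"
    and triv: "\<And>\<phi> K. \<phi> \<in> E \<Longrightarrow> subgroup K G \<Longrightarrow> K \<subseteq> U \<phi> \<Longrightarrow> \<phi> \<in> Irr_trivial_on G T K"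
    by blast
  have "openin T (topspace T \<inter> \<Inter>(U ` E))"
    by (rule openin_Int_Inter) (use \<open>finite E\<close> U in auto)
  moreover have "\<one> \<in> topspace T \<inter> \<Inter>(U ` E)" using U by (auto simp: topspace_eq)
  ultimately have "\<exists>K. K \<lhd> G \<and> openin T K \<and> K \<subseteq> topspace T \<inter> \<Inter>(U ` E) \<and> p ^ N dvd order (G Mod K)"
    by (rule open_normal_subgroup_large_index[OF inf vp p])
  then obtain K where K: "K \<lhd> G" "openin T K" "K \<subseteq> topspace T \<inter> \<Inter>(U ` E)"
    "p ^ N dvd order (G Mod K)"
    by (elim exE conjE)
  let ?I = "Irr_trivial_on G T K"
  have "E \<subseteq> ?I"
  proof
    fix \<phi> assume \<phi>: "\<phi> \<in> E"
    have "subgroup K G" "K \<subseteq> U \<phi>" using K \<phi> normal_imp_subgroup by auto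
    then show "\<phi> \<in> ?I" by (rule triv[OF \<phi>])
  qed
  have I: "?I \<subseteq> Irr G T" unfolding Irr_trivial_on_def Irr_def by blast
  \<comment> \<open>Character values are complex numbers; the identity is moved to the integers,
    where divisibility has content.\<close>
  have "complex_of_int (\<Sum>\<phi>\<in>?I. int (d \<phi>) ^ 2) = (\<Sum>\<phi>\<in>?I. \<phi> \<one> ^ 2)"
    using I d by (auto intro!: sum.cong)
  also have "\<dots> = complex_of_int (int (order (G Mod K)))"
    using Irr_trivial_on_sum_squares(2)[OF K(1,2)] by simp
  finally have "(\<Sum>\<phi>\<in>?I. int (d \<phi>) ^ 2) = int (order (G Mod K))"
    unfolding of_int_eq_iff .
  moreover have "(\<Sum>\<phi>\<in>?I. int (d \<phi>) ^ 2) = (\<Sum>\<phi>\<in>?I - E. int (d \<phi>) ^ 2) + (\<Sum>\<phi>\<in>E. int (d \<phi>) ^ 2)"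
    by (rule sum.subset_diff[OF \<open>E \<subseteq> ?I\<close> Irr_trivial_on_sum_squares(1)[OF K(1,2)]])
  moreover have "int p ^ N dvd (\<Sum>\<phi>\<in>?I - E. int (d \<phi>) ^ 2)"
  proof (rule dvd_sum)
    fix \<phi> assume "\<phi> \<in> ?I - E"
    then have "p ^ N dvd d \<phi>" using I by (auto simp: E_def)
    then have "int p ^ N dvd int (d \<phi>)" by (metis of_nat_dvd_iff of_nat_power)
    then show "int p ^ N dvd int (d \<phi>) ^ 2" by (simp add: power2_eq_square)
  qed
  moreover have "int p ^ N dvd int (order (G Mod K))"
    using K(4) by (metis of_nat_dvd_iff of_nat_power)
  ultimately have "int p ^ N dvd (\<Sum>\<phi>\<in>E. int (d \<phi>) ^ 2)"
    by (metis dvd_add_right_iff)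
  also have "(\<Sum>\<phi>\<in>E. int (d \<phi>) ^ 2) = (\<Sum>n\<in>d ` E. \<Sum>\<phi>\<in>{\<phi> \<in> E. d \<phi> = n}. int (d \<phi>) ^ 2)"
    by (rule sum.image_gen[OF \<open>finite E\<close>])
  also have "\<dots> = (\<Sum>n\<in>?S. int (rep_count G T n) * int n ^ 2)"
    unfolding dE by (intro sum.cong refl) (simp add: count)
  finally show ?thesis .
qed


subsection \<open>Dirichlet series and rationality\<close>

lemma of_nat_mult_powr:
  "of_nat (m * n) powr (z :: complex) = of_nat m powr z * of_nat n powr z"
  using powr_times_real[of "of_nat m" "of_nat n" z] by simp

lemma norm_of_nat_powr: "norm (of_nat n powr (z :: complex)) = real n powr Re z"
  using norm_powr_real_powr[of "of_nat n" z] by simp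

lemma has_sum_dilate:
  fixes c :: "nat \<Rightarrow> int" and s S :: complex
  assumes p: "p > 0" and c: "((\<lambda>n. of_int (c n) * of_nat n powr (-s)) has_sum S) (UNIV :: nat set)"
  shows "((\<lambda>n. of_int (dilate p c n) * of_nat n powr (-s)) has_sum (of_nat p powr (-s) * S)) (UNIV :: nat set)"
    (is "(?f has_sum _) _")
proof -
  have "((\<lambda>n. of_nat p powr (-s) * (of_int (c n) * of_nat n powr (-s))) has_sum (of_nat p powr (-s) * S)) UNIV"
    by (rule has_sum_cmult_right[OF c])
  also have "(\<lambda>n. of_nat p powr (-s) * (of_int (c n) * of_nat n powr (-s))) = ?f \<circ> (\<lambda>n. p * n)"
    using p by (auto simp: dilate_def of_nat_mult_powr fun_eq_iff simp del: of_nat_mult)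
  finally have "(?f has_sum (of_nat p powr (-s) * S)) (range (\<lambda>n. p * n))"
    using p by (subst has_sum_reindex) (auto simp: inj_on_def o_def)
  also have "?this \<longleftrightarrow> ?thesis"
    by (rule has_sum_cong_neutral) (auto simp: dilate_def)
  finally show ?thesis .
qed

lemma has_sum_poly_act:
  fixes c :: "nat \<Rightarrow> int" and s S :: complex
  assumes p: "p > 0" and c: "((\<lambda>n. of_int (c n) * of_nat n powr (-s)) has_sum S) (UNIV :: nat set)"
  shows "((\<lambda>n. of_int (poly_act p D c n) * of_nat n powr (-s)) has_sum
    (poly (map_poly of_int D) (of_nat p powr (-s)) * S)) (UNIV :: nat set)"
proof (induction D)
  case 0
  then show ?case by simp
next
  case (pCons a D)
  have "((\<lambda>n. of_int a * (of_int (c n) * of_nat n powr (-s)) +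
        of_int (dilate p (poly_act p D c) n) * of_nat n powr (-s)) has_sum
      (of_int a * S + of_nat p powr (-s) * (poly (map_poly of_int D) (of_nat p powr (-s)) * S))) UNIV"
    by (intro has_sum_add has_sum_cmult_right c has_sum_dilate p pCons.IH)
  then show ?case
    by (simp add: poly_act_pCons[OF p] of_int_hom.map_poly_pCons_hom algebra_simps)
qed

lemma has_sum_sum_lessThan:
  fixes f :: "nat \<Rightarrow> 'a \<Rightarrow> 'b :: topological_comm_monoid_add"
  assumes "\<And>i. (f i has_sum S i) A"
  shows "((\<lambda>x. \<Sum>i<k. f i x) has_sum (\<Sum>i<k. S i)) A"
  by (induction k) (auto intro!: has_sum_add assms)

text \<open>Once all smaller coefficients vanish, c n n^(-s) is minus the tail over k > n. At s = t
  + j that tail is at most A (n + 1)^(-j), with \<open>A\<close> the absolute sum at t. Multiplying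
  by n^s leaves a bound proportional to (n / (n + 1))^j, which tends to 0 as j grows.\<close>

lemma Dirichlet_coefficients_unique:
  fixes c :: "nat \<Rightarrow> complex"
  assumes sum: "\<And>s :: real. s > \<sigma> \<Longrightarrow> ((\<lambda>n. c n * of_nat n powr (- of_real s)) has_sum 0) UNIV"
    and "n > 0"
  shows "c n = 0"
  using \<open>n > 0\<close>
proof (induction n rule: less_induct)
  case (less n)
  define t where "t = \<sigma> + 1"
  have "(\<lambda>k. c k * of_nat k powr (- of_real t)) summable_on UNIV"
    using sum[of t] by (auto simp: t_def summable_on_def)
  then have abs: "(\<lambda>k. norm (c k * of_nat k powr (- of_real t))) summable_on UNIV"
    by (simp add: summable_on_iff_abs_summable_on_complex)
  define A where "A = (\<Sum>\<^sub>\<infinity>k. norm (c k * of_nat k powr (- of_real t)))"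
  define q where "q = real n / (real n + 1)"
  have q: "0 < q" "q < 1" using less.prems by (auto simp: q_def)
  have bound: "norm (c n) \<le> real n powr t * A * q ^ j" for j
  proof -
    define s where "s = t + real j"
    let ?f = "\<lambda>k. c k * of_nat k powr (- of_real s) :: complex"
    have "(?f has_sum 0) UNIV" using sum[of s] by (simp add: s_def t_def)
    moreover have "(?f has_sum ?f n) {n}" by (rule has_sum_finiteI) auto
    ultimately have "(?f has_sum (0 - ?f n)) (UNIV - {n})" by (rule has_sum_Diff) auto
    then have eq: "(\<Sum>\<^sub>\<infinity>k\<in>UNIV - {n}. ?f k) = - ?f n" by (simp add: infsumI)
    have le: "norm (?f k) \<le> norm (c k * of_nat k powr (- of_real t)) * (1 / (real n + 1)) ^ j"
      if "k \<in> UNIV - {n}" for k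
    proof -
      from that have "k \<noteq> n" by simp
      then consider "k = 0" | "0 < k" "k < n" | "k > n" by linarith
      then show ?thesis
      proof cases
        case 2
        then show ?thesis using less.IH[of k] by simp
      next
        case 3
        have "real k powr (- s) = real k powr (- t) * (1 / real k) ^ j"
          using 3 by (simp add: s_def powr_add powr_minus powr_diff powr_realpow power_divide field_simps)
        also have "\<dots> \<le> real k powr (- t) * (1 / (real n + 1)) ^ j"
          using 3 by (intro mult_left_mono power_mono divide_left_mono) auto
        finally show ?thesis
          by (simp add: norm_mult norm_of_nat_powr mult_left_mono mult.assoc)
      qed simp
    qed
    have "norm (?f n) = norm (\<Sum>\<^sub>\<infinity>k\<in>UNIV - {n}. ?f k)" unfolding eq by simp
    also have "\<dots> \<le> (\<Sum>\<^sub>\<infinity>k\<in>UNIV - {n}. norm (c k * of_nat k powr (- of_real t)) * (1 / (real n + 1)) ^ j)"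
    proof (rule norm_infsum_le)
      show "(?f has_sum (\<Sum>\<^sub>\<infinity>k\<in>UNIV - {n}. ?f k)) (UNIV - {n})"
        by (rule has_sum_infsum[OF has_sum_imp_summable[OF \<open>(?f has_sum (0 - ?f n)) (UNIV - {n})\<close>]])
      show "((\<lambda>k. norm (c k * of_nat k powr (- of_real t)) * (1 / (real n + 1)) ^ j) has_sum
        (\<Sum>\<^sub>\<infinity>k\<in>UNIV - {n}. norm (c k * of_nat k powr (- of_real t)) * (1 / (real n + 1)) ^ j)) (UNIV - {n})"
        by (intro has_sum_infsum summable_on_cmult_left summable_on_subset_banach[OF abs]) auto
    qed (use le in auto)
    also have "\<dots> \<le> A * (1 / (real n + 1)) ^ j"
    proof -
      have "(\<Sum>\<^sub>\<infinity>k\<in>UNIV - {n}. norm (c k * of_nat k powr (- of_real t))) \<le> A"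
        unfolding A_def by (rule infsum_mono_neutral) (auto intro: summable_on_subset_banach[OF abs] abs)
      then show ?thesis
        by (subst infsum_cmult_left') (simp add: mult_right_mono)
    qed
    finally have "norm (c n) * real n powr (- s) \<le> A * (1 / (real n + 1)) ^ j"
      by (simp add: norm_mult norm_of_nat_powr)
    then have "norm (c n) * real n powr (- s) * real n powr s \<le> A * (1 / (real n + 1)) ^ j * real n powr s"
      by (rule mult_right_mono) simp
    moreover have "norm (c n) * real n powr (- s) * real n powr s = norm (c n)"
      using less.prems by (simp add: powr_minus)
    ultimately have "norm (c n) \<le> A * (1 / (real n + 1)) ^ j * real n powr s" by simp
    also have "real n powr s = real n powr t * real n ^ j"
      using less.prems by (simp add: s_def powr_add powr_realpow)
    finally show ?thesis by (simp add: q_def power_divide mult_ac)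
  qed
  have "(\<lambda>j. real n powr t * A * q ^ j) \<longlonglongrightarrow> real n powr t * A * 0"
    using q by (intro tendsto_mult_left LIMSEQ_power_zero) simp
  then have "norm (c n) \<le> real n powr t * A * 0"
    by (rule LIMSEQ_le_const) (use bound in blast)
  then show ?case by simp
qed

text \<open>Upgrades the ordered series to an unordered sum. The coefficients are nonnegative, so
  the norm of a term at s is the term at the real point Re s, and convergence there is absolute
  convergence at s.\<close>

lemma rep_zeta_has_sum:
  assumes G: "group G" and conv: "\<And>s. Re s > \<sigma> \<Longrightarrow> rep_zeta_converges G T s" and s: "Re s > \<sigma>"
  shows "((\<lambda>n. of_int (int (rep_count G T n)) * of_nat n powr (-s)) has_sum rep_zeta G T s) UNIV"
proof -
  let ?f = "\<lambda>s n. of_nat (rep_count G T n) * of_nat n powr (-s) :: complex"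
  have sums: "?f s sums rep_zeta G T s" if "Re s > \<sigma>" for s
  proof -
    have "(\<lambda>n. ?f s (Suc n)) sums rep_zeta G T s"
      by (rule rep_zeta_Dirichlet_series(2)[OF G conv[OF that]])
    then show ?thesis by (subst (asm) sums_Suc_iff) simp
  qed
  have norm: "norm (?f s n) = Re (?f (of_real (Re s)) n)" for n
  proof -
    have "of_nat n powr (- of_real (Re s)) = complex_of_real (real n powr (- Re s))"
      by (subst powr_of_real[symmetric]) auto
    then show ?thesis by (simp add: norm_mult norm_of_nat_powr)
  qed
  have "summable (?f (of_real (Re s)))" using sums[of "of_real (Re s)"] s by (simp add: sums_iff)
  then have "summable (\<lambda>n. norm (?f s n))" unfolding norm by (rule summable_Re)
  from norm_summable_imp_has_sum[OF this sums[OF s]] show ?thesis by simp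
qed

section \<open>From rational functions to an integer polynomial annihilator\<close>

lemma rat_poly_clear_denominators:
  fixes q :: "rat poly"
  shows "\<exists>(a::int) E. a \<noteq> 0 \<and> Polynomial.smult (of_int a) q = map_poly of_int E"
proof (induction q)
  case 0
  then show ?case by (intro exI[of _ 1] exI[of _ 0]) simp
next
  case (pCons c q)
  then obtain a E where aE: "a \<noteq> 0" "Polynomial.smult (of_int a) q = map_poly of_int E" by blast
  obtain x y where xy: "quotient_of c = (x, y)" by (cases "quotient_of c")
  then have y: "y \<noteq> 0" "c = of_int x / of_int y"
    using quotient_of_div quotient_of_denom_pos by fastforce+
  have "Polynomial.smult (of_int (a * y)) (pCons c q) = map_poly of_int (pCons (a * x) (Polynomial.smult y E))"
    using y aE(2)[symmetric] by (simp add: of_int_hom.map_poly_pCons_hom of_int_hom.map_poly_hom_smult mult.commute)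
  then show ?case using aE(1) y(1) by (intro exI[of _ "a * y"] exI) auto
qed

text \<open>The relation says that D R_i is the integer polynomial N in the field of rational
  functions, written by cross multiplication with the numerator and denominator of R_i.\<close>

lemma common_denominator:
  fixes R :: "nat \<Rightarrow> rat poly fract"
  shows "\<exists>D :: int poly. D \<noteq> 0 \<and> (\<forall>i<k. \<exists>N :: int poly.
    map_poly of_int D * fst (quot_of_fract (R i)) = map_poly of_int N * snd (quot_of_fract (R i)))"
proof (induction k)
  case 0
  then show ?case by (intro exI[of _ 1]) simp
next
  case (Suc k)
  then obtain D :: "int poly" where D: "D \<noteq> 0" and N: "\<And>i. i < k \<Longrightarrow> \<exists>N :: int poly.
    map_poly of_int D * fst (quot_of_fract (R i)) = map_poly of_int N * snd (quot_of_fract (R i))" by blast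
  define u where "u = fst (quot_of_fract (R k))"
  define v where "v = snd (quot_of_fract (R k))"
  have v: "v \<noteq> 0" by (simp add: v_def)
  obtain a E where aE: "a \<noteq> 0" "Polynomial.smult (of_int a) v = map_poly of_int E"
    using rat_poly_clear_denominators by blast
  obtain b M where bM: "b \<noteq> 0" "Polynomial.smult (of_int b) u = map_poly of_int M"
    using rat_poly_clear_denominators by blast
  have "E \<noteq> 0"
  proof
    assume "E = 0"
    then have "Polynomial.smult (of_int a) v = 0" using aE(2) by simp
    then show False using aE(1) v by simp
  qed
  let ?E = "Polynomial.smult b E"
  have Ek: "map_poly of_int ?E * u = map_poly of_int (Polynomial.smult a M) * v"
    using aE(2)[symmetric] bM(2)[symmetric] by (simp add: of_int_hom.map_poly_hom_smult mult.commute)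
  show ?case
  proof (rule exI[of _ "D * ?E"], intro conjI allI impI)
    show "D * ?E \<noteq> 0" using D \<open>E \<noteq> 0\<close> bM(1) by simp
    fix i assume "i < Suc k"
    show "\<exists>N. map_poly of_int (D * ?E) * fst (quot_of_fract (R i)) =
        map_poly of_int N * snd (quot_of_fract (R i))"
    proof (cases "i = k")
      case True
      have "map_poly of_int (D * ?E) * u = map_poly of_int (D * Polynomial.smult a M) * v"
        by (simp only: of_int_poly_hom.hom_mult mult.assoc Ek)
      then show ?thesis using True u_def v_def by blast
    next
      case False
      then obtain N where "map_poly of_int D * fst (quot_of_fract (R i)) =
          map_poly of_int N * snd (quot_of_fract (R i))"
        using N \<open>i < Suc k\<close> by (metis less_SucE)
      then have "map_poly of_int D * fst (quot_of_fract (R i)) * map_poly of_int ?E =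
          map_poly of_int N * snd (quot_of_fract (R i)) * map_poly of_int ?E" by simp
      then have "map_poly of_int (D * ?E) * fst (quot_of_fract (R i)) =
          map_poly of_int (N * ?E) * snd (quot_of_fract (R i))"
        by (simp only: of_int_poly_hom.hom_mult ac_simps)
      then show ?thesis by blast
    qed
  qed
qed

text \<open>The nonzero roots of \<open>q\<close> keep a positive distance from 0, while p^(-s) is
  nonzero and tends to 0 as Re s grows. A root at 0 does no harm.\<close>

lemma poly_nonzero_right_half_plane:
  fixes q :: "complex poly"
  assumes "q \<noteq> 0" "p > 1"
  shows "\<exists>\<sigma>. \<forall>s. Re s > \<sigma> \<longrightarrow> poly q (of_nat p powr (-s)) \<noteq> 0"
proof -
  obtain \<delta> where \<delta>: "\<delta> > 0" "\<And>x. poly q x = 0 \<Longrightarrow> x \<noteq> 0 \<Longrightarrow> \<delta> \<le> dist 0 x"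
    using finite_set_avoid[OF poly_roots_finite[OF assms(1)], of 0] by blast
  have "poly q (of_nat p powr (-s)) \<noteq> 0" if "Re s > - log p \<delta>" for s
  proof
    assume "poly q (of_nat p powr (-s)) = 0"
    then have "\<delta> \<le> norm (of_nat p powr (-s) :: complex)"
      using \<delta>(2) assms(2) by force
    also have "\<dots> = real p powr (- Re s)" by (simp add: norm_of_nat_powr)
    also have "\<dots> < real p powr (log p \<delta>)" using that assms(2) by (intro powr_less_mono) auto
    also have "\<dots> = \<delta>" using \<delta>(1) assms(2) by simp
    finally show False by simp
  qed
  then show ?thesis by blast
qed

lemma map_poly_of_rat_of_int:
  "map_poly (of_rat :: rat \<Rightarrow> complex) (map_poly of_int D) = map_poly of_int D"
  by (intro poly_eqI) (simp add: coeff_map_poly)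

lemma eval_ratfun_cleared:
  assumes "map_poly of_int D * fst (quot_of_fract R) = map_poly of_int N * snd (quot_of_fract R)"
    and "poly (map_poly of_rat (snd (quot_of_fract R))) x \<noteq> 0"
  shows "poly (map_poly of_int D) x * eval_ratfun R x = poly (map_poly of_int N) x"
proof -
  interpret h: map_poly_comm_ring_hom "of_rat :: rat \<Rightarrow> complex" ..
  have "poly (map_poly of_rat (map_poly of_int D * fst (quot_of_fract R))) x =
      poly (map_poly of_rat (map_poly of_int N * snd (quot_of_fract R))) x" using assms(1) by simp
  then have "poly (map_poly of_int D) x * poly (map_poly of_rat (fst (quot_of_fract R))) x =
      poly (map_poly of_int N) x * poly (map_poly of_rat (snd (quot_of_fract R))) x"
    by (simp add: h.hom_mult map_poly_of_rat_of_int)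
  then show ?thesis using assms(2) by (simp add: eval_ratfun_def field_simps)
qed

text \<open>Multiplying by a common denominator turns the zeta function into the sum of the
  N_i(p^(-s)) m_i^(-s), which is a Dirichlet polynomial. Uniqueness of coefficients identifies its
  coefficients with those of the action on the character counts.\<close>

lemma rational_rep_zeta_poly_act:
  assumes G: "group G" and p: "p > 1" and rat: "has_rational_rep_zeta p G T"
    and r0: "rep_count G T 0 = 0"
  shows "\<exists>D. D \<noteq> 0 \<and> finite {n. poly_act p D (\<lambda>n. int (rep_count G T n)) n \<noteq> 0}"
proof -
  define r where "r = (\<lambda>n. int (rep_count G T n))"
  obtain k :: nat and m :: "nat \<Rightarrow> nat" and R where ext: "extends_rep_zeta G T
      (\<lambda>s. \<Sum>i<k. of_nat (m i) powr (-s) * eval_ratfun (R i) (of_nat p powr (-s)))"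
    using rat unfolding has_rational_rep_zeta_def by (elim exE conjE) (rule that)
  then obtain \<sigma> where "\<forall>s. Re s > \<sigma> \<longrightarrow> rep_zeta_converges G T s \<and> rep_zeta G T s =
      (\<Sum>i<k. of_nat (m i) powr (-s) * eval_ratfun (R i) (of_nat p powr (-s)))"
    unfolding extends_rep_zeta_def by (elim exE)
  then have conv: "rep_zeta_converges G T s" and eq: "rep_zeta G T s =
      (\<Sum>i<k. of_nat (m i) powr (-s) * eval_ratfun (R i) (of_nat p powr (-s)))"
    if "Re s > \<sigma>" for s using that by simp_all
  obtain D :: "int poly" where D: "D \<noteq> 0" and "\<forall>i<k. \<exists>N :: int poly.
    map_poly of_int D * fst (quot_of_fract (R i)) = map_poly of_int N * snd (quot_of_fract (R i))"
    using common_denominator[of k R] by (elim exE conjE)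
  then have "\<forall>i. \<exists>N :: int poly. i < k \<longrightarrow>
    map_poly of_int D * fst (quot_of_fract (R i)) = map_poly of_int N * snd (quot_of_fract (R i))"
    by simp
  from choice[OF this] obtain N :: "nat \<Rightarrow> int poly" where "\<forall>i. i < k \<longrightarrow>
    map_poly of_int D * fst (quot_of_fract (R i)) = map_poly of_int (N i) * snd (quot_of_fract (R i))"
    by (elim exE)
  then have N: "map_poly of_int D * fst (quot_of_fract (R i)) =
      map_poly of_int (N i) * snd (quot_of_fract (R i))" if "i < k" for i
    using that by simp
  \<comment> \<open>The product of all denominators: one half plane then avoids all poles at
    once.\<close>
  define q :: "complex poly" where "q = (\<Prod>i<k. map_poly of_rat (snd (quot_of_fract (R i))))"
  have "q \<noteq> 0" by (simp add: q_def map_poly_eq_0_iff)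
  then obtain \<sigma>' where \<sigma>': "\<And>s. Re s > \<sigma>' \<Longrightarrow> poly q (of_nat p powr (-s)) \<noteq> 0"
    using poly_nonzero_right_half_plane[OF _ p] by blast
  \<comment> \<open>The arithmetic function with Dirichlet series m_i^(-s).\<close>
  define \<delta> where "\<delta> i n = (if n = m i then 1 else 0 :: int)" for i n
  define b where "b n = (\<Sum>i<k. poly_act p (N i) (\<delta> i) n)" for n
  have "poly_act p D r n - b n = 0" if "n > 0" for n
  proof -
    have "complex_of_int (poly_act p D r n - b n) = 0"
    proof (rule Dirichlet_coefficients_unique[where \<sigma> = "max \<sigma> \<sigma>'", OF _ that])
      fix t :: real assume t: "t > max \<sigma> \<sigma>'"
      define s where "s = complex_of_real t"
      have s: "Re s > \<sigma>" "Re s > \<sigma>'" using t by (auto simp: s_def)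
      define x where "x = of_nat p powr (-s)"
      have "((\<lambda>n. of_int (\<delta> i n) * of_nat n powr (-s)) has_sum of_nat (m i) powr (-s)) UNIV" for i
        by (rule has_sum_finite_neutralI[of "{m i}"]) (auto simp: \<delta>_def)
      then have "((\<lambda>n. of_int (poly_act p (N i) (\<delta> i) n) * of_nat n powr (-s)) has_sum
          (poly (map_poly of_int (N i)) x * of_nat (m i) powr (-s))) UNIV" for i
        unfolding x_def using p by (intro has_sum_poly_act) auto
      then have "((\<lambda>n. \<Sum>i<k. of_int (poly_act p (N i) (\<delta> i) n) * of_nat n powr (-s)) has_sum
          (\<Sum>i<k. poly (map_poly of_int (N i)) x * of_nat (m i) powr (-s))) UNIV"
        by (rule has_sum_sum_lessThan)
      moreover have "((\<lambda>n. of_int (poly_act p D r n) * of_nat n powr (-s)) has_sum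
          (poly (map_poly of_int D) x * rep_zeta G T s)) UNIV"
        unfolding x_def r_def using p
        by (intro has_sum_poly_act rep_zeta_has_sum[OF G conv s(1)]) auto
      moreover have "poly (map_poly of_int D) x * rep_zeta G T s =
          (\<Sum>i<k. poly (map_poly of_int (N i)) x * of_nat (m i) powr (-s))"
      proof -
        have ev: "poly (map_poly of_int D) x * eval_ratfun (R i) x = poly (map_poly of_int (N i)) x" if "i < k" for i
        proof (rule eval_ratfun_cleared[OF N[OF that]])
          show "poly (map_poly of_rat (snd (quot_of_fract (R i)))) x \<noteq> 0"
            using \<sigma>'[OF s(2)] that by (auto simp: q_def poly_prod x_def)
        qed
        show ?thesis
          unfolding eq[OF s(1), folded x_def] sum_distrib_left
        proof (rule sum.cong[OF refl])
          fix i assume "i \<in> {..<k}"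
          then show "poly (map_poly of_int D) x * (of_nat (m i) powr (-s) * eval_ratfun (R i) x) =
              poly (map_poly of_int (N i)) x * of_nat (m i) powr (-s)"
            using ev[of i, symmetric] by simp
        qed
      qed
      ultimately have "((\<lambda>n. of_int (poly_act p D r n) * of_nat n powr (-s) +
          - (\<Sum>i<k. of_int (poly_act p (N i) (\<delta> i) n) * of_nat n powr (-s))) has_sum
          ((\<Sum>i<k. poly (map_poly of_int (N i)) x * of_nat (m i) powr (-s)) +
          - (\<Sum>i<k. poly (map_poly of_int (N i)) x * of_nat (m i) powr (-s)))) UNIV"
        by (intro has_sum_add) (simp_all add: has_sum_uminus)
      then show "((\<lambda>n. complex_of_int (poly_act p D r n - b n) * of_nat n powr (- of_real t)) has_sum 0) UNIV"
        by (simp add: b_def s_def sum_distrib_right left_diff_distrib)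
    qed
    then show ?thesis by (metis of_int_eq_0_iff)
  qed
  moreover have "poly_act p D r 0 = 0" by (rule poly_act_at_0) (simp add: r_def r0)
  ultimately have "poly_act p D r n = (if n = 0 then 0 else b n)" for n by auto
  moreover have "finite {n. b n \<noteq> 0}"
  proof (rule finite_subset)
    show "{n. b n \<noteq> 0} \<subseteq> (\<Union>i\<in>{..<k}. {n. poly_act p (N i) (\<delta> i) n \<noteq> 0})"
      unfolding b_def by (auto dest: sum.not_neutral_contains_not_neutral)
    show "finite (\<Union>i\<in>{..<k}. {n. poly_act p (N i) (\<delta> i) n \<noteq> 0})"
    proof (intro finite_UN_I finite_poly_act_support)
      show "finite {n. \<delta> i n \<noteq> 0}" for i by (rule finite_subset[of _ "{m i}"]) (auto simp: \<delta>_def)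
    qed (use p in auto)
  qed
  ultimately have "finite {n. poly_act p D r n \<noteq> 0}"
    by (elim rev_finite_subset) (auto split: if_splits)
  then show ?thesis using D unfolding r_def by blast
qed


subsection \<open>The zero at \<open>-2\<close>\<close>

theorem theorem1:
  fixes p :: nat and G :: "('a, 'b) monoid_scheme" and T :: "'a topology"
  assumes "prime p"
    and "profinite_group G T"
    and "topologically_fin_gen G T"
    and "FAb G T"
    and "infinite (carrier G)"
    and "virtually_pro_p p G T"
    and "has_rational_rep_zeta p G T"
  shows "\<not> is_pole (rep_zeta_continuation G T) (-2) \<and> rep_zeta_continuation G T (-2) = 0"
proof -
  interpret profinite_group G T by fact
  have p: "p > 1" and p0: "p > 0" using \<open>prime p\<close> by (auto dest: prime_gt_1_nat prime_gt_0_nat)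
  define r where "r = (\<lambda>n. int (rep_count G T n))"
  have r0: "rep_count G T 0 = 0"
  proof -
    have "{\<phi> \<in> Irr G T. \<phi> \<one>\<^bsub>G\<^esub> = of_nat 0} = {}" using Irr_degree[OF group_axioms] by fastforce
    then show ?thesis by (simp only: rep_count_def card.empty)
  qed
  obtain F\<^sub>0 where "extends_rep_zeta G T F\<^sub>0"
    using assms(7) unfolding has_rational_rep_zeta_def by (elim exE conjE) (rule that)
  then obtain \<sigma> where "\<forall>s. Re s > \<sigma> \<longrightarrow> rep_zeta_converges G T s \<and> rep_zeta G T s = F\<^sub>0 s"
    unfolding extends_rep_zeta_def by (elim exE)
  then have conv: "rep_zeta_converges G T s" if "Re s > \<sigma>" for s using that by simp
  have fin: "finite {\<phi> \<in> Irr G T. \<phi> \<one>\<^bsub>G\<^esub> = of_nat n}" for n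
    by (rule rep_zeta_Dirichlet_series(1)[OF group_axioms conv[of "of_real (\<sigma> + 1)"]]) simp
  define Q where "Q D \<longleftrightarrow> D \<noteq> 0 \<and> finite {n. poly_act p D r n \<noteq> 0}" for D
  have "\<exists>D. Q D"
    using rational_rep_zeta_poly_act[OF group_axioms p assms(7) r0] by (simp add: Q_def r_def)
  then obtain D where "Q D" and min: "\<And>E. Q E \<Longrightarrow> degree D \<le> degree E"
    using ex_has_least_nat[of Q _ degree] by blast
  then have D: "D \<noteq> 0" "finite {n. poly_act p D r n \<noteq> 0}" by (auto simp: Q_def)
  note roots = minimal_poly_act_nonroots[OF p D min[unfolded Q_def, OF conjI]]
  define c where "c = poly_act p D r"
  have fin_c: "finite {n. c n \<noteq> 0}" using D(2) by (simp add: c_def)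
  have c0: "c 0 = 0" unfolding c_def by (rule poly_act_at_0) (simp add: r_def r0)
  have moment: "second_moment c = 0"
    unfolding c_def
  proof (rule second_moment_vanishes[OF p roots(1) D(2)])
    fix N
    have "{n. \<not> p ^ N dvd n \<and> r n \<noteq> 0} = {n. \<not> p ^ N dvd n \<and> rep_count G T n \<noteq> 0}"
      by (simp add: r_def)
    moreover have "finite {n. \<not> p ^ N dvd n \<and> r n \<noteq> 0}"
      by (rule finite_support_off_power[OF p0 roots(1) D(2)])
    ultimately show "int p ^ N dvd (\<Sum>n | \<not> p ^ N dvd n \<and> r n \<noteq> 0. r n * int n ^ 2)"
      using degree_square_sum_dvd[OF assms(5,6) p fin] by (simp add: r_def)
  qed
  define q :: "complex poly" where "q = map_poly of_int D"
  have "q \<noteq> 0" using D(1) by (simp add: q_def map_poly_eq_0_iff)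
  \<comment> \<open>The explicit continuation, a Dirichlet polynomial over D(p^(-s)). It may have
    removable singularities, so \<open>remove_sings F\<close> is compared with
    \<open>rep_zeta_continuation\<close>.\<close>
  define F where "F s = (\<Sum>n | c n \<noteq> 0. of_int (c n) * of_nat n powr (-s)) / poly q (of_nat p powr (-s))" for s
  have num_ana: "(\<lambda>s. \<Sum>n | c n \<noteq> 0. of_int (c n) * of_nat n powr (-s) :: complex) analytic_on A" for A
  proof (intro analytic_intros)
    fix n s assume "n \<in> {n. c n \<noteq> 0}"
    then have "n > 0" using c0 by (cases n) auto
    then show "of_nat n \<notin> (\<real>\<^sub>\<le>\<^sub>0 :: complex set)" by simp
  qed
  have den_ana: "(\<lambda>s. poly q (of_nat p powr (-s))) analytic_on A" for A
    unfolding poly_altdef using p0 by (intro analytic_intros) auto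
  have F_ana: "F analytic_on {s}" if "poly q (of_nat p powr (-s)) \<noteq> 0" for s
    unfolding F_def by (intro analytic_on_divide num_ana den_ana) (use that in auto)
  have F_mero: "F meromorphic_on UNIV"
    unfolding F_def by (intro meromorphic_intros analytic_on_imp_meromorphic_on num_ana den_ana)
  obtain \<sigma>' where \<sigma>': "\<And>s. Re s > \<sigma>' \<Longrightarrow> poly q (of_nat p powr (-s)) \<noteq> 0"
    using poly_nonzero_right_half_plane[OF \<open>q \<noteq> 0\<close> p] by blast
  have F_eq: "rep_zeta G T s = F s" if s: "Re s > \<sigma>" "Re s > \<sigma>'" for s
  proof -
    have "((\<lambda>n. of_int (c n) * of_nat n powr (-s)) has_sum (poly q (of_nat p powr (-s)) * rep_zeta G T s)) UNIV"
      unfolding q_def c_def r_def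
      by (intro has_sum_poly_act p0 rep_zeta_has_sum[OF group_axioms conv s(1)])
    moreover have "((\<lambda>n. of_int (c n) * of_nat n powr (-s)) has_sum
        (\<Sum>n | c n \<noteq> 0. of_int (c n) * of_nat n powr (-s))) UNIV"
      using fin_c by (rule has_sum_finite_neutralI) auto
    ultimately have "poly q (of_nat p powr (-s)) * rep_zeta G T s =
        (\<Sum>n | c n \<noteq> 0. of_int (c n) * of_nat n powr (-s))"
      by (rule has_sum_unique)
    then show ?thesis using \<sigma>'[OF s(2)] by (simp add: F_def field_simps)
  qed
  have "extends_rep_zeta G T (remove_sings F)"
    unfolding extends_rep_zeta_def
    by (intro exI[of _ "max \<sigma> \<sigma>'"] allI impI conjI conv) (auto simp: F_eq F_ana \<sigma>')
  then have cont: "rep_zeta_continuation G T = remove_sings F"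
    by (rule rep_zeta_continuation_unique[OF remove_sings_nicely_meromorphic[OF F_mero]])
  have sq: "of_nat n powr (- (- 2)) = (of_int (int n ^ 2) :: complex)" for n
    using powr_nat[of "of_nat n :: complex" 2] by simp
  have q2: "poly q (of_nat p powr (- (- 2))) = of_int (poly D (int p ^ 2))"
    unfolding sq q_def by (rule of_int_hom.poly_map_poly)
  \<comment> \<open>At s = -2 the denominator is D(p^2), nonzero by minimality. Hence
    \<open>F\<close> is analytic there, and removing singularities changes neither its value nor
    creates a pole.\<close>
  have "poly q (of_nat p powr (- (- 2))) \<noteq> 0"
    unfolding q2 of_int_eq_0_iff by (rule roots(2))
  note ana = F_ana[OF this]
  have "F (- 2) = of_int (second_moment c) / poly q (of_nat p powr (- (- 2)))"
    unfolding F_def sq second_moment_def by simp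
  then have "F (- 2) = 0" using moment by simp
  moreover have "\<not> is_pole (remove_sings F) (- 2)"
  proof -
    obtain S where "open S" "- 2 \<in> S" "remove_sings F holomorphic_on S"
      using remove_sings_analytic_on[OF ana] unfolding analytic_at by (elim exE conjE)
    then show ?thesis by (rule not_is_pole_holomorphic)
  qed
  ultimately show ?thesis unfolding cont using ana by simp
qed

end
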